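(* Let $q$ be a prime power and let $\mathcal{S}$ be any subset of the set of primes in $\mathbb{F}_q[T]$ that has a natural density $\delta(\mathcal{S})$. Then $$\lim_{x\to\infty}\ \sum_{\substack{A\in\mathbb{F}_q[T]\text{ monic}\\ 1\le\deg A\le x\\ A\in\mathcal{D}(\mathcal{S})}}\frac{\mu(A)\,\Omega(A)}{q^{\deg A}}=0.$$
   Context: A prime in $\mathbb{F}_q[T]$ is a monic irreducible polynomial; $\mathcal{P}$ is the set of all primes. For $\mathcal{S}\subseteq\mathcal{P}$, $\pi_{\mathcal{S}}(n)=\#\{P\in\mathcal{S}:\deg P=n\}$, and the natural density of $\mathcal{S}$ is $\delta(\mathcal{S})=\lim_{n\to\infty}\pi_{\mathcal{S}}(n)/\pi_{\mathcal{P}}(n)$, provided the limit exists. For monic $A$, $\mu(A)=1$ if $A=1$, $\mu(A)=(-1)^k$ if $A$ is a product of $k$ distinct primes, and $\mu(A)=0$ otherwise. $\mathcal{N}(A)=\{\deg P: P\text{ prime}, P\mid A\}$, $\Omega(A)=\#\mathcal{N}(A)$ is the number of distinct degrees of prime divisors of $A$ (not the number of prime factors), and $\delta_1(A)$ is the smallest element of $\mathcal{N}(A)$ (with $\delta_1(1)=0$). $P_{\min}(A)=\{P\text{ prime}: P\mid A,\ \deg P=\delta_1(A)\}$, and $\mathcal{D}(\mathcal{S})$ is the set of monic $A\in\mathbb{F}_q[T]$ such that $P_{\min}(A)$ has exactly one element $P$ and $P\in\mathcal{S}$. *)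

theory Defs
  imports Complex_Main "HOL-Library.Cardinality" "HOL-Computational_Algebra.Polynomial_Factorial"
begin

text \<open>
  The field with \<open>q\<close> elements is a type \<open>'a :: {finite, field}\<close> with \<open>q = CARD('a)\<close>.
\<close>

definition monic_poly :: "'a::field poly \<Rightarrow> bool" where
  "monic_poly A \<longleftrightarrow> lead_coeff A = 1"

definition prime_polys :: "'a::field poly set" where
  "prime_polys = {P. monic_poly P \<and> irreducible P}"

definition deg_count :: "'a::field poly set \<Rightarrow> nat \<Rightarrow> nat" where
  "deg_count S n = card {P \<in> S. degree P = n}"

definition has_natural_density :: "'a::field poly set \<Rightarrow> real \<Rightarrow> bool" where
  "has_natural_density S d \<longleftrightarrow>
     (\<lambda>n. real (deg_count S n) / real (deg_count (prime_polys :: 'a poly set) n)) \<longlonglongrightarrow> d"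

definition prime_divisors :: "'a::field poly \<Rightarrow> 'a poly set" where
  "prime_divisors A = {P \<in> prime_polys. P dvd A}"

text \<open>
  The empty set \<open>F\<close> gives the value \<open>1\<close> at \<open>A = 1\<close>. That the exponent is the number of
  factors in any such product is lemma \<open>moebius_poly_prod\<close> below.
\<close>

definition moebius_poly :: "'a::field poly \<Rightarrow> int" where
  "moebius_poly A =
     (if \<exists>F. finite F \<and> F \<subseteq> prime_polys \<and> A = \<Prod>F
      then (-1) ^ card (prime_divisors A) else 0)"

definition prime_degrees :: "'a::field poly \<Rightarrow> nat set" where
  "prime_degrees A = degree ` prime_divisors A"

definition Omega_deg :: "'a::field poly \<Rightarrow> nat" where
  "Omega_deg A = card (prime_degrees A)"

definition min_prime_degree :: "'a::field poly \<Rightarrow> nat" where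
  "min_prime_degree A = (if A = 1 then 0 else Min (prime_degrees A))"

definition P_min :: "'a::field poly \<Rightarrow> 'a poly set" where
  "P_min A = {P \<in> prime_divisors A. degree P = min_prime_degree A}"

definition D_set :: "'a::field poly set \<Rightarrow> 'a poly set" where
  "D_set S = {A. monic_poly A \<and> (\<exists>P. P_min A = {P} \<and> P \<in> S)}"

lemma prime_polys_dvd_eq:
  assumes "P \<in> prime_polys" "Q \<in> prime_polys" "P dvd Q"
  shows "P = Q"
proof -
  have irr: "irreducible P" "irreducible Q" and m: "lead_coeff P = 1" "lead_coeff Q = 1"
    using assms by (auto simp: prime_polys_def monic_poly_def)
  have "\<not> P dvd 1" using irr by (simp add: irreducible_def)
  then have "Q dvd P" using irr(2) assms(3) irreducibleD' by blast
  then obtain R where R: "P = Q * R" by (elim dvdE)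
  from assms(3) obtain T where T: "Q = P * T" by (elim dvdE)
  have "P \<noteq> 0" using irr by auto
  then have "T * R = 1" using R T by (metis mult.assoc mult_cancel_left1)
  then have "R dvd 1" by (metis dvd_triv_right)
  then obtain c where c: "R = [:c:]" by (auto simp: is_unit_poly_iff)
  have "lead_coeff P = lead_coeff Q * lead_coeff R" unfolding R by (rule lead_coeff_mult)
  then have "c = 1" using m unfolding c by simp
  then show ?thesis using R c by simp
qed

lemma prime_divisors_prod:
  assumes "finite F" "F \<subseteq> prime_polys"
  shows "prime_divisors (\<Prod>F) = F"
proof
  show "F \<subseteq> prime_divisors (\<Prod>F)"
    using assms by (auto simp: prime_divisors_def intro: dvd_prodI)
  show "prime_divisors (\<Prod>F) \<subseteq> F"
  proof
    fix P assume P: "P \<in> prime_divisors (\<Prod>F)"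
    have "prime_elem P"
      using P
      by (auto simp: prime_divisors_def prime_polys_def intro: field_poly_irreducible_imp_prime)
    have "\<exists>Q\<in>F. P dvd Q" if "P dvd \<Prod>F"
      using assms(1) that
    proof (induction F rule: finite_induct)
      case empty
      then show ?case using \<open>prime_elem P\<close> prime_elem_not_unit by auto
    next
      case (insert Q F)
      then have "P dvd Q \<or> P dvd \<Prod>F"
        using \<open>prime_elem P\<close> by (simp add: prime_elem_dvd_mult_iff)
      then show ?case using insert.IH by blast
    qed
    then obtain Q where "Q \<in> F" "P dvd Q"
      using P unfolding prime_divisors_def by blast
    then show "P \<in> F"
      using P assms(2) prime_polys_dvd_eq unfolding prime_divisors_def by blast
  qed
qed

lemma moebius_poly_prod:
  assumes "finite F" "F \<subseteq> prime_polys"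
  shows "moebius_poly (\<Prod>F) = (-1) ^ card F"
  using assms by (auto simp: moebius_poly_def prime_divisors_prod)

lemma finite_polys_degree_le:
  "finite {A :: 'a::{finite, field} poly. degree A \<le> n}"
proof (rule finite_subset)
  show "{A :: 'a poly. degree A \<le> n} \<subseteq> Poly ` {xs. set xs \<subseteq> UNIV \<and> length xs \<le> Suc n}"
  proof
    fix A :: "'a poly" assume "A \<in> {A. degree A \<le> n}"
    then have "length (coeffs A) \<le> Suc n"
      by (cases "A = 0") (auto simp: length_coeffs_degree)
    then show "A \<in> Poly ` {xs. set xs \<subseteq> UNIV \<and> length xs \<le> Suc n}"
      by (intro image_eqI[of _ _ "coeffs A"]) auto
  qed
  show "finite (Poly ` {xs :: 'a list. set xs \<subseteq> UNIV \<and> length xs \<le> Suc n})"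
    by (intro finite_imageI finite_lists_length_le) simp
qed

end

theory Submission
  imports Defs "HOL-Analysis.Summation_Tests"
begin

text \<open>
  Since there are exactly \<open>q ^ (n - deg A)\<close> monic multiples of \<open>A\<close> of degree \<open>n\<close>, the partial sum up to
  degree \<open>n\<close> of \<open>a(A) / q ^ deg A\<close> is the mean of \<open>\<Sum>A dvd C. a(A)\<close> over the monic \<open>C\<close> of degree \<open>n\<close>. For
  \<open>a(A) = \<mu>(A) \<Omega>(A)\<close> restricted to \<open>\<D>(S)\<close>, the divisor sum is the number of primes of \<open>S\<close> dividing
  \<open>C\<close> whose degree is the second largest among the degrees of prime divisors of \<open>C\<close>, minus the number
  of those whose degree is the largest (a duality of Alladi's type). Each of the two counts has mean tending to \<open>\<delta>(S)\<close>, so the difference tends to \<open>0\<close>: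
  the mean of either count is \<open>\<Sum>d. #S\<^sub>d w(n, d)\<close> with weights independent of \<open>S\<close>, each tending to \<open>0\<close>
  as \<open>n\<close> grows, which reduces the claim to the set of all primes. For that set the count is \<open>1\<close> unless
  two primes of equal large degree divide \<open>C\<close> (rare as \<open>\<pi>(d) \<le> q ^ d / d\<close>) or \<open>C\<close> has prime
  divisors of few large degrees (rare by a sieve and the divergence of \<open>\<Sum>d. \<pi>(d) / q ^ d\<close>).
\<close>

section \<open>Means over monic polynomials of fixed degree\<close>

definition monics :: "nat \<Rightarrow> 'a::field poly set" where
  "monics n = {A. monic_poly A \<and> degree A = n}"

text \<open>The denominator is the cardinality of \<open>monics n\<close> (lemma
  \<open>card_monics\<close>), so this is the expectation for a uniformly random monic polynomial of
  degree \<open>n\<close>.\<close>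

definition mean :: "nat \<Rightarrow> ('a::{finite, field} poly \<Rightarrow> real) \<Rightarrow> real" where
  "mean n f = (\<Sum>A\<in>monics n. f A) / real CARD('a) ^ n"

text \<open>This ranks prime divisors by degree: for a prime divisor \<open>P\<close> of
  \<open>A\<close>, the value at \<open>degree P\<close> is 0 when its degree is the largest in
  \<open>prime_degrees A\<close>, and 1 when it is the second largest.\<close>

definition above :: "nat \<Rightarrow> 'a::field poly \<Rightarrow> nat" where
  "above d A = card {m \<in> prime_degrees A. d < m}"

lemma card_field_ge_2: "2 \<le> CARD('a::{finite, field})"
proof -
  have "card {0, 1 :: 'a} \<le> CARD('a)" by (rule card_mono) auto
  then show ?thesis by simp
qed

lemma monic_poly_nonzero: "monic_poly A \<Longrightarrow> A \<noteq> 0"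
  by (auto simp: monic_poly_def)

lemma monics_nonzero: "A \<in> monics n \<Longrightarrow> A \<noteq> 0"
  by (simp add: monics_def monic_poly_nonzero)

lemma monic_poly_mult_iff: "monic_poly B \<Longrightarrow> monic_poly (B * A) \<longleftrightarrow> monic_poly A"
  by (simp add: monic_poly_def lead_coeff_mult)

lemma degree_mult_monic: "monic_poly B \<Longrightarrow> monic_poly A \<Longrightarrow> degree (B * A) = degree B + degree A"
  using monic_poly_nonzero degree_mult_eq by blast

lemma monic_poly_degree_0: "monic_poly A \<Longrightarrow> degree A = 0 \<Longrightarrow> A = 1"
  by (auto simp: monic_poly_def one_pCons elim: degree_eq_zeroE)

lemma finite_monics [simp]: "finite (monics n :: 'a::{finite, field} poly set)"
  by (rule finite_subset[OF _ finite_polys_degree_le[of n]]) (auto simp: monics_def)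

lemma monics_0: "monics 0 = {1}"
  using monic_poly_degree_0 by (auto simp: monics_def monic_poly_def)

lemma bij_betw_monics_Suc:
  "bij_betw (\<lambda>(a, A). pCons a A) (UNIV \<times> monics n) (monics (Suc n) :: 'a::field poly set)"
  unfolding bij_betw_def
proof
  show "inj_on (\<lambda>(a, A). pCons a A) (UNIV \<times> (monics n :: 'a poly set))"
    by (auto simp: inj_on_def)
  show "(\<lambda>(a, A). pCons a A) ` (UNIV \<times> monics n) = (monics (Suc n) :: 'a poly set)"
  proof (intro equalityI subsetI)
    fix B :: "'a poly" assume "B \<in> (\<lambda>(a, A). pCons a A) ` (UNIV \<times> monics n)"
    then obtain a A where B: "B = pCons a A" "A \<in> monics n" by auto
    then have "A \<noteq> 0" by (auto simp: monics_def monic_poly_def)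
    then show "B \<in> monics (Suc n)"
      using B by (auto simp: monics_def monic_poly_def)
  next
    fix B :: "'a poly" assume B: "B \<in> monics (Suc n)"
    obtain a A where aA: "B = pCons a A" by (cases B) auto
    have "A \<noteq> 0" using B aA by (auto simp: monics_def)
    then have "A \<in> monics n" using B aA by (auto simp: monics_def monic_poly_def)
    then show "B \<in> (\<lambda>(a, A). pCons a A) ` (UNIV \<times> monics n)"
      using aA by auto
  qed
qed

lemma card_monics: "card (monics n :: 'a::{finite, field} poly set) = CARD('a) ^ n"
proof (induction n)
  case (Suc n)
  have "card (monics (Suc n) :: 'a poly set) = card ((UNIV :: 'a set) \<times> (monics n :: 'a poly set))"
    by (rule bij_betw_same_card[OF bij_betw_monics_Suc, symmetric])
  then show ?case using Suc by (simp add: card_cartesian_product)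
qed (simp add: monics_0)

lemma mean_const: "mean n (\<lambda>A::'a::{finite, field} poly. c) = c"
  by (simp add: mean_def card_monics)

lemma mean_add: "mean n (\<lambda>A. f A + g A) = mean n f + mean n g"
  by (simp add: mean_def sum.distrib add_divide_distrib)

lemma mean_diff: "mean n (\<lambda>A. f A - g A) = mean n f - mean n g"
  by (simp add: mean_def sum_subtractf diff_divide_distrib)

lemma mean_cmult: "mean n (\<lambda>A. c * f A) = c * mean n f"
  by (simp add: mean_def sum_distrib_left)

lemma mean_sum: "mean n (\<lambda>A. \<Sum>x\<in>X. f x A) = (\<Sum>x\<in>X. mean n (f x))"
  unfolding mean_def by (subst sum.swap) (simp add: sum_divide_distrib)

lemma mean_cong: "(\<And>A. A \<in> monics n \<Longrightarrow> f A = g A) \<Longrightarrow> mean n f = mean n g"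
  by (simp add: mean_def)

lemma mean_mono: "(\<And>A. A \<in> monics n \<Longrightarrow> f A \<le> g A) \<Longrightarrow> mean n f \<le> mean n g"
  unfolding mean_def by (intro divide_right_mono sum_mono) auto

lemma mean_nonneg: "(\<And>A. A \<in> monics n \<Longrightarrow> 0 \<le> f A) \<Longrightarrow> 0 \<le> mean n f"
  unfolding mean_def by (intro divide_nonneg_nonneg sum_nonneg) auto

lemma abs_mean_le: "\<bar>mean n f\<bar> \<le> mean n (\<lambda>A. \<bar>f A\<bar>)"
  unfolding mean_def by (auto simp: abs_divide intro: divide_right_mono)

section \<open>Divisibility conditions under the mean\<close>

lemma bij_betw_mult_monics:
  assumes "monic_poly B" "degree B \<le> n"
  shows "bij_betw ((*) B) (monics (n - degree B)) {A \<in> monics n. B dvd A}"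
  unfolding bij_betw_def
proof
  show "inj_on ((*) B) (monics (n - degree B))"
    using monic_poly_nonzero[OF assms(1)] by (auto simp: inj_on_def)
  show "(*) B ` monics (n - degree B) = {A \<in> monics n. B dvd A}"
  proof (intro equalityI subsetI)
    fix A assume "A \<in> (*) B ` monics (n - degree B)"
    then show "A \<in> {A \<in> monics n. B dvd A}"
      using assms by (auto simp: monics_def monic_poly_mult_iff degree_mult_monic)
  next
    fix A assume A: "A \<in> {A \<in> monics n. B dvd A}"
    then obtain C where C: "A = B * C" by (auto elim: dvdE)
    then have "C \<in> monics (n - degree B)"
      using A assms by (auto simp: monics_def monic_poly_mult_iff degree_mult_monic)
    then show "A \<in> (*) B ` monics (n - degree B)" using C by blast
  qed
qed

text \<open>Multiples of \<open>B\<close> are substituted as \<open>B * A\<close> with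
  \<open>A\<close> monic of degree \<open>n - degree B\<close>. The degree hypothesis keeps this
  subtraction from truncating; \<open>mean_dvd_eq_0\<close> is the complementary case.\<close>

lemma mean_dvd:
  fixes B :: "'a::{finite, field} poly"
  assumes "monic_poly B" "degree B \<le> n"
  shows "mean n (\<lambda>A. of_bool (B dvd A) * g A)
    = mean (n - degree B) (\<lambda>A. g (B * A)) / real CARD('a) ^ degree B"
proof -
  have "(\<Sum>A\<in>monics n. of_bool (B dvd A) * g A) = (\<Sum>A | A \<in> monics n \<and> B dvd A. g A)"
    by (rule sum.mono_neutral_cong_right) auto
  also have "\<dots> = (\<Sum>A\<in>monics (n - degree B). g (B * A))"
    using sum.reindex_bij_betw[OF bij_betw_mult_monics[OF assms], of g] by simp
  finally show ?thesis
    using assms by (simp add: mean_def flip: power_add)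
qed

lemma mean_dvd_eq_0:
  assumes "n < degree B"
  shows "mean n (\<lambda>A. of_bool (B dvd A) * g A) = 0"
proof -
  have "\<not> B dvd A" if "A \<in> monics n" for A
    using that assms dvd_imp_degree_le[of B A] monic_poly_nonzero by (force simp: monics_def)
  then show ?thesis by (simp add: mean_def)
qed

lemma mean_of_bool_dvd:
  fixes B :: "'a::{finite, field} poly"
  assumes "monic_poly B"
  shows "mean n (\<lambda>A. of_bool (B dvd A)) = of_bool (degree B \<le> n) / real CARD('a) ^ degree B"
  using mean_dvd[OF assms, of n "\<lambda>_. 1"] mean_dvd_eq_0[of n B "\<lambda>_. 1"] mean_const[of _ 1]
  by (cases "degree B \<le> n") auto

text \<open>A monic \<open>A\<close> of degree at most \<open>n\<close> divides a random monic
  \<open>C\<close> of degree \<open>n\<close> with probability exactly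
  \<open>1 / q ^ degree A\<close>, so exchanging the sums gives an identity without error
  term.\<close>

lemma sum_over_degree_le_eq_mean:
  fixes a :: "'a::{finite, field} poly \<Rightarrow> real"
  shows "(\<Sum>A | monic_poly A \<and> degree A \<le> n. a A / real CARD('a) ^ degree A)
    = mean n (\<lambda>C. \<Sum>A | monic_poly A \<and> A dvd C. a A)"
proof -
  let ?X = "{A :: 'a poly. monic_poly A \<and> degree A \<le> n}"
  have fin: "finite ?X"
    by (rule finite_subset[OF _ finite_polys_degree_le[of n]]) auto
  have "mean n (\<lambda>C. \<Sum>A | monic_poly A \<and> A dvd C. a A)
      = mean n (\<lambda>C. \<Sum>A\<in>?X. a A * of_bool (A dvd C))"
  proof (rule mean_cong)
    fix C :: "'a poly" assume C: "C \<in> monics n"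
    have "degree A \<le> n" if "A dvd C" for A
      using that C dvd_imp_degree_le[of A C] monic_poly_nonzero by (force simp: monics_def)
    then show "(\<Sum>A | monic_poly A \<and> A dvd C. a A) = (\<Sum>A\<in>?X. a A * of_bool (A dvd C))"
      by (intro sum.mono_neutral_cong_left fin) auto
  qed
  also have "\<dots> = (\<Sum>A\<in>?X. a A * (of_bool (degree A \<le> n) / real CARD('a) ^ degree A))"
    unfolding mean_sum mean_cmult by (rule sum.cong) (auto simp: mean_of_bool_dvd)
  also have "\<dots> = (\<Sum>A\<in>?X. a A / real CARD('a) ^ degree A)"
    by (rule sum.cong) auto
  finally show ?thesis by simp
qed

section \<open>Prime divisors\<close>

lemma prime_polysD:
  assumes "P \<in> prime_polys"
  shows "monic_poly P" "prime_elem P" "0 < degree P"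
proof -
  show "monic_poly P" "prime_elem P"
    using assms by (auto simp: prime_polys_def intro: field_poly_irreducible_imp_prime)
  then show "0 < degree P"
    using monic_poly_degree_0[of P] by (cases "degree P = 0") auto
qed

lemma finite_prime_divisors:
  fixes A :: "'a::{finite, field} poly"
  assumes "A \<noteq> 0"
  shows "finite (prime_divisors A)"
  by (rule finite_subset[OF _ finite_polys_degree_le[of "degree A"]])
     (use assms in \<open>auto simp: prime_divisors_def dvd_imp_degree_le\<close>)

lemma finite_prime_polys_degree [simp]:
  "finite {P \<in> X. degree P = n}" "finite {P \<in> X. degree P \<le> n}"
  if "X \<subseteq> (prime_polys :: 'a::{finite, field} poly set)"
  by (rule finite_subset[OF _ finite_polys_degree_le[of n]]; auto)+

lemma prime_poly_dvd_mult:
  assumes "P \<in> prime_polys" "Q \<in> prime_polys" "P \<noteq> Q"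
  shows "P dvd Q * A \<longleftrightarrow> P dvd A"
  using prime_polys_dvd_eq[OF assms(1,2)] prime_elem_dvd_mult_iff[OF prime_polysD(2)[OF assms(1)]]
    assms(3) by blast

lemma prime_divisors_mult:
  assumes "P \<in> prime_polys"
  shows "prime_divisors (P * A) = insert P (prime_divisors A)"
  using assms prime_poly_dvd_mult[of _ P A] by (auto simp: prime_divisors_def)

lemma ex_prime_divisor:
  fixes A :: "'a::field poly"
  assumes "monic_poly A" "A \<noteq> 1"
  shows "\<exists>P. P \<in> prime_divisors A"
  using assms
proof (induction "degree A" arbitrary: A rule: less_induct)
  case less
  show ?case
  proof (cases "irreducible A")
    case True
    then show ?thesis using less.prems by (auto simp: prime_divisors_def prime_polys_def)
  next
    case False
    have "A \<noteq> 0" using less.prems monic_poly_nonzero by blast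
    moreover have "\<not> is_unit A"
      using less.prems monic_poly_degree_0 \<open>A \<noteq> 0\<close> by (simp add: is_unit_iff_degree) blast
    ultimately obtain B C where A: "A = B * C" "\<not> is_unit B" "\<not> is_unit C"
      using False by (auto simp: irreducible_def)
    then have nz: "B \<noteq> 0" "C \<noteq> 0" using \<open>A \<noteq> 0\<close> by auto
    have pos: "0 < degree B" "0 < degree C"
      using A nz is_unit_iff_degree by auto
    \<comment> \<open>Dividing by the leading coefficient makes the proper factor monic, as the
      induction hypothesis requires.\<close>
    define B' where "B' = smult (inverse (lead_coeff B)) B"
    have "monic_poly B'" "degree B' = degree B"
      using nz by (auto simp: B'_def monic_poly_def)
    moreover have "degree B' < degree A"
      using A nz pos \<open>degree B' = degree B\<close> by (simp add: degree_mult_eq)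
    moreover have "B' \<noteq> 1" using pos \<open>degree B' = degree B\<close> by auto
    ultimately obtain P where "P \<in> prime_divisors B'" using less.hyps by blast
    moreover have "B' dvd A"
      unfolding A(1) B'_def using nz by (simp add: smult_dvd)
    ultimately show ?thesis by (auto simp: prime_divisors_def intro: dvd_trans)
  qed
qed

section \<open>Duality\<close>

lemma sum_Pow_sign:
  assumes "finite R"
  shows "(\<Sum>G\<in>Pow R. (- 1 :: real) ^ card G) = of_bool (R = {})"
  using assms
proof (induction R rule: finite_induct)
  case (insert x R)
  have inj: "inj_on (insert x) (Pow R)"
    using insert.hyps by (auto simp: inj_on_def)
  have "(\<Sum>G\<in>Pow (insert x R). (- 1 :: real) ^ card G)
      = (\<Sum>G\<in>Pow R. (- 1) ^ card G) + (\<Sum>G\<in>insert x ` Pow R. (- 1) ^ card G)"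
    unfolding Pow_insert using insert.hyps by (intro sum.union_disjoint) auto
  also have "(\<Sum>G\<in>insert x ` Pow R. (- 1 :: real) ^ card G) = (\<Sum>G\<in>Pow R. - ((- 1) ^ card G))"
    unfolding sum.reindex[OF inj] comp_def
  proof (rule sum.cong)
    fix G assume "G \<in> Pow R"
    then have "finite G" "x \<notin> G" using insert.hyps finite_subset by auto
    then show "(- 1 :: real) ^ card (insert x G) = - ((- 1) ^ card G)" by simp
  qed simp
  finally show ?case by (simp add: sum_negf)
qed simp

lemma sum_Pow_sign_card_image:
  fixes f :: "'b \<Rightarrow> nat"
  assumes "finite R"
  shows "(\<Sum>G\<in>Pow R. (- 1) ^ card G * (1 + real (card (f ` G))))
    = of_bool (card (f ` R) = 0) - of_bool (card (f ` R) = 1)"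
proof -
  define c where "c = (\<Sum>G\<in>Pow R. (- 1 :: real) ^ card G)"
  have c: "c = of_bool (card (f ` R) = 0)"
    using assms by (simp add: c_def sum_Pow_sign)
  have "(\<Sum>G\<in>Pow R. (- 1) ^ card G * real (card (f ` G)))
      = (\<Sum>G\<in>Pow R. \<Sum>m\<in>f ` R. (- 1) ^ card G * (1 - of_bool (G \<subseteq> {x \<in> R. f x \<noteq> m})))"
  proof (rule sum.cong)
    fix G assume G: "G \<in> Pow R"
    have "real (card (f ` G)) = (\<Sum>m\<in>f ` R. of_bool (m \<in> f ` G))"
    proof -
      have "f ` R \<inter> {m. m \<in> f ` G} = f ` G" using G by auto
      then show ?thesis using assms by simp
    qed
    also have "\<dots> = (\<Sum>m\<in>f ` R. 1 - of_bool (G \<subseteq> {x \<in> R. f x \<noteq> m}))"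
    proof (rule sum.cong)
      fix m
      have "m \<in> f ` G \<longleftrightarrow> \<not> G \<subseteq> {x \<in> R. f x \<noteq> m}" using G by blast
      then show "of_bool (m \<in> f ` G) = (1 - of_bool (G \<subseteq> {x \<in> R. f x \<noteq> m}) :: real)"
        by simp
    qed simp
    finally show "(- 1) ^ card G * real (card (f ` G))
        = (\<Sum>m\<in>f ` R. (- 1) ^ card G * (1 - of_bool (G \<subseteq> {x \<in> R. f x \<noteq> m})))"
      by (simp add: sum_distrib_left)
  qed simp
  also have "\<dots> = (\<Sum>m\<in>f ` R. c - (\<Sum>G\<in>Pow R. (- 1) ^ card G * of_bool (G \<subseteq> {x \<in> R. f x \<noteq> m})))"
    by (subst sum.swap) (simp add: c_def algebra_simps sum_subtractf)
  also have "\<dots> = (\<Sum>m\<in>f ` R. - of_bool (f ` R = {m}))"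
  proof (rule sum.cong)
    fix m assume m: "m \<in> f ` R"
    have "(\<Sum>G\<in>Pow R. (- 1 :: real) ^ card G * of_bool (G \<subseteq> {x \<in> R. f x \<noteq> m}))
        = (\<Sum>G\<in>Pow {x \<in> R. f x \<noteq> m}. (- 1) ^ card G)"
      using assms by (intro sum.mono_neutral_cong_right) auto
    also have "\<dots> = of_bool (f ` R = {m})"
      using assms m by (subst sum_Pow_sign) auto
    finally show "c - (\<Sum>G\<in>Pow R. (- 1) ^ card G * of_bool (G \<subseteq> {x \<in> R. f x \<noteq> m}))
        = - of_bool (f ` R = {m})"
      using m assms by (auto simp: c)
  qed simp
  also have "\<dots> = - of_bool (card (f ` R) = 1)"
  proof (cases "card (f ` R) = 1")
    case True
    then obtain m where "f ` R = {m}" by (auto simp: card_1_singleton_iff)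
    then show ?thesis by simp
  next
    case False
    then have "f ` R \<noteq> {m}" for m by (metis card_1_singleton_iff One_nat_def)
    then show ?thesis using False by simp
  qed
  finally show ?thesis
    using c by (simp add: c_def distrib_left sum.distrib)
qed

text \<open>This is the combinatorial core of the duality, applied later with
  \<open>f = degree\<close> and \<open>R\<close> the prime divisors of \<open>C\<close>. A subset
  with a unique minimiser \<open>P\<close> is \<open>insert P G\<close>, where \<open>G\<close> is
  an arbitrary set of elements with larger \<open>f\<close>-value; for fixed \<open>P\<close> the
  sum over \<open>G\<close> is evaluated by \<open>sum_Pow_sign_card_image\<close>.\<close>

lemma sum_subsets_unique_min:
  fixes f :: "'b \<Rightarrow> nat"
  assumes "finite R"
  shows "(\<Sum>F | F \<subseteq> R \<and> (\<exists>P. {Q \<in> F. f Q = Min (f ` F)} = {P} \<and> P \<in> S).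
            (- 1) ^ card F * real (card (f ` F)))
    = (\<Sum>P\<in>R \<inter> S. of_bool (card {m \<in> f ` R. f P < m} = 1)
                   - of_bool (card {m \<in> f ` R. f P < m} = 0))"
proof -
  let ?U = "\<lambda>P. {Q \<in> R. f P < f Q}"
  \<comment> \<open>The empty \<open>F\<close> is excluded whatever \<open>Min {}\<close> is,
    because the filtered set is then empty and not a singleton.\<close>
  let ?X = "{F. F \<subseteq> R \<and> (\<exists>P. {Q \<in> F. f Q = Min (f ` F)} = {P} \<and> P \<in> S)}"
  let ?Y = "SIGMA P:R \<inter> S. Pow (?U P)"
  let ?w = "\<lambda>F. (- 1) ^ card F * real (card (f ` F))"
  have min: "Min (f ` insert P G) = f P" "{Q \<in> insert P G. f Q = f P} = {P}"
    if "G \<subseteq> ?U P" for P G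
  proof -
    have "finite G" using that assms finite_subset by fastforce
    then show "Min (f ` insert P G) = f P"
      using that by (intro Min_eqI) auto
    show "{Q \<in> insert P G. f Q = f P} = {P}" using that by auto
  qed
  have bij: "bij_betw (\<lambda>(P, G). insert P G) ?Y ?X"
    unfolding bij_betw_def
  proof
    show "inj_on (\<lambda>(P, G). insert P G) ?Y"
    proof (rule inj_onI, clarify)
      fix P G P' G' assume *: "G \<subseteq> ?U P" "G' \<subseteq> ?U P'" "insert P G = insert P' G'"
      then have "f P = f P'" using min(1)[OF *(1)] min(1)[OF *(2)] by simp
      then have "{P} = {P'}" using min(2)[OF *(1)] min(2)[OF *(2)] *(3) by simp
      moreover have "P \<notin> G" "P' \<notin> G'" using * by auto
      ultimately show "P = P' \<and> G = G'" using *(3) by auto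
    qed
    show "(\<lambda>(P, G). insert P G) ` ?Y = ?X"
    proof (intro equalityI subsetI)
      fix F assume "F \<in> (\<lambda>(P, G). insert P G) ` ?Y"
      then obtain P G where *: "F = insert P G" "P \<in> R" "P \<in> S" "G \<subseteq> ?U P" by auto
      then show "F \<in> ?X" using min[OF *(4)] by auto
    next
      fix F assume F: "F \<in> ?X"
      then obtain P where P: "{Q \<in> F. f Q = Min (f ` F)} = {P}" "P \<in> S" by auto
      have "finite F" using F assms finite_subset by auto
      then have le: "Min (f ` F) \<le> f Q" if "Q \<in> F" for Q using that by simp
      have PF: "P \<in> F" "f P = Min (f ` F)" using P(1) by auto
      have "f P < f Q" if "Q \<in> F - {P}" for Q
        using that le[of Q] P(1) PF by (cases "f Q = Min (f ` F)") auto
      then have "F - {P} \<subseteq> ?U P" using F by auto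
      then have "(P, F - {P}) \<in> ?Y" using PF F P(2) by auto
      moreover have "F = insert P (F - {P})" using PF by auto
      ultimately show "F \<in> (\<lambda>(P, G). insert P G) ` ?Y"
        by (intro image_eqI[of _ _ "(P, F - {P})"]) simp_all
    qed
  qed
  have "(\<Sum>F\<in>?X. ?w F) = (\<Sum>(P, G)\<in>?Y. ?w (insert P G))"
    using sum.reindex_bij_betw[OF bij, of ?w] by (simp add: case_prod_unfold)
  also have "\<dots> = (\<Sum>P\<in>R \<inter> S. \<Sum>G\<in>Pow (?U P). ?w (insert P G))"
    using assms by (subst sum.Sigma) auto
  \<comment> \<open>Adjoining \<open>P\<close> flips the sign and adds exactly one value, since
    \<open>f P\<close> is smaller than every value on \<open>G\<close>.\<close>
  also have "\<dots> = (\<Sum>P\<in>R \<inter> S. - (\<Sum>G\<in>Pow (?U P). (- 1) ^ card G * (1 + real (card (f ` G)))))"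
    unfolding sum_negf[symmetric]
  proof (intro sum.cong refl)
    fix P G assume G: "G \<in> Pow (?U P)"
    then have "finite G" using assms finite_subset by fastforce
    moreover have "P \<notin> G" "f P \<notin> f ` G" using G by auto
    ultimately show "?w (insert P G) = - ((- 1) ^ card G * (1 + real (card (f ` G))))"
      by (simp add: algebra_simps)
  qed
  also have "\<dots> = (\<Sum>P\<in>R \<inter> S. of_bool (card {m \<in> f ` R. f P < m} = 1)
                   - of_bool (card {m \<in> f ` R. f P < m} = 0))"
  proof (rule sum.cong)
    fix P
    have "f ` ?U P = {m \<in> f ` R. f P < m}" by auto
    then show "- (\<Sum>G\<in>Pow (?U P). (- 1) ^ card G * (1 + real (card (f ` G))))
        = of_bool (card {m \<in> f ` R. f P < m} = 1) - of_bool (card {m \<in> f ` R. f P < m} = 0)"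
      using assms by (subst sum_Pow_sign_card_image) auto
  qed simp
  finally show ?thesis .
qed

lemma prod_primes_dvd_iff:
  assumes "finite F" "F \<subseteq> prime_polys"
  shows "\<Prod>F dvd C \<longleftrightarrow> F \<subseteq> prime_divisors C"
proof
  assume "\<Prod>F dvd C"
  then show "F \<subseteq> prime_divisors C"
    using assms by (auto simp: prime_divisors_def intro: dvd_trans[OF dvd_prodI])
next
  assume "F \<subseteq> prime_divisors C"
  with assms show "\<Prod>F dvd C"
  proof (induction F rule: finite_induct)
    case (insert P F)
    then obtain B where B: "C = \<Prod>F * B" by (auto elim: dvdE)
    have P: "prime_elem P" "P dvd C"
      using insert.prems prime_polysD(2) by (auto simp: prime_divisors_def)
    have "P \<notin> prime_divisors (\<Prod>F)"
      using insert.hyps insert.prems by (simp add: prime_divisors_prod)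
    then have "\<not> P dvd \<Prod>F" using insert.prems by (auto simp: prime_divisors_def)
    then have "P dvd B" using P prime_elem_dvd_mult_iff unfolding B by blast
    then show ?case using insert.hyps unfolding B by (auto simp: mult.commute intro: mult_dvd_mono)
  qed simp
qed

lemma monic_prod_primes: "F \<subseteq> prime_polys \<Longrightarrow> monic_poly (\<Prod>F)"
  by (auto simp: monic_poly_def lead_coeff_prod prime_polys_def intro: prod.neutral)

lemma P_min_prod:
  fixes F :: "'a::field poly set"
  assumes "finite F" "F \<subseteq> prime_polys"
  shows "P_min (\<Prod>F) = {Q \<in> F. degree Q = Min (degree ` F)}"
proof (cases "F = {}")
  case True
  then show ?thesis using prime_divisors_prod[of "{} :: 'a poly set"] by (auto simp: P_min_def)
next
  case False
  then have "\<Prod>F \<noteq> 1"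
    using prime_divisors_prod[OF assms] prime_divisors_prod[of "{} :: 'a poly set"] by auto
  then show ?thesis
    using assms by (auto simp: P_min_def min_prime_degree_def prime_degrees_def prime_divisors_prod)
qed

text \<open>Only squarefree \<open>A\<close> contribute, and the squarefree monic divisors of
  \<open>C\<close> are the products of sets \<open>F\<close> of prime divisors of \<open>C\<close>.
  For such a product the summand depends only on \<open>card F\<close> and on the number of degrees
  in \<open>F\<close>, which reduces the claim to \<open>sum_subsets_unique_min\<close>.\<close>

lemma sum_moebius_Omega_divisors:
  fixes C :: "'a::{finite, field} poly"
  assumes "C \<noteq> 0"
  shows "(\<Sum>A | monic_poly A \<and> A dvd C.
            of_bool (A \<in> D_set S) * (real_of_int (moebius_poly A) * real (Omega_deg A)))
    = (\<Sum>P\<in>prime_divisors C \<inter> S. of_bool (above (degree P) C = 1) - of_bool (above (degree P) C = 0))"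
proof -
  let ?R = "prime_divisors C"
  let ?X = "{F. F \<subseteq> ?R \<and> (\<exists>P. {Q \<in> F. degree Q = Min (degree ` F)} = {P} \<and> P \<in> S)}"
  have finR: "finite ?R" by (rule finite_prime_divisors[OF assms])
  have sub: "finite F" "F \<subseteq> prime_polys" if "F \<in> ?X" for F
  proof -
    have "F \<subseteq> ?R" using that by simp
    then show "finite F" using finR by (rule finite_subset)
    show "F \<subseteq> prime_polys" using \<open>F \<subseteq> ?R\<close> unfolding prime_divisors_def by blast
  qed
  have inj: "inj_on (\<lambda>F. \<Prod>F) ?X"
  proof (rule inj_on_inverseI)
    fix F assume "F \<in> ?X"
    then show "prime_divisors (\<Prod>F) = F" by (intro prime_divisors_prod sub)
  qed
  have "(\<Sum>A | monic_poly A \<and> A dvd C.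
            of_bool (A \<in> D_set S) * (real_of_int (moebius_poly A) * real (Omega_deg A)))
      = (\<Sum>A\<in>(\<lambda>F. \<Prod>F) ` ?X. real_of_int (moebius_poly A) * real (Omega_deg A))"
  proof (rule sum.mono_neutral_cong_right)
    show "finite {A. monic_poly A \<and> A dvd C}"
      by (rule finite_subset[OF _ finite_polys_degree_le[of "degree C"]])
         (use assms in \<open>auto simp: dvd_imp_degree_le\<close>)
    show "(\<lambda>F. \<Prod>F) ` ?X \<subseteq> {A. monic_poly A \<and> A dvd C}"
      using sub by (auto simp: monic_prod_primes prod_primes_dvd_iff)
    show "\<forall>A\<in>{A. monic_poly A \<and> A dvd C} - (\<lambda>F. \<Prod>F) ` ?X.
        of_bool (A \<in> D_set S) * (real_of_int (moebius_poly A) * real (Omega_deg A)) = 0"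
    proof (rule ballI, rule ccontr)
      fix A
      assume A: "A \<in> {A. monic_poly A \<and> A dvd C} - (\<lambda>F. \<Prod>F) ` ?X"
        and nz: "of_bool (A \<in> D_set S) * (real_of_int (moebius_poly A) * real (Omega_deg A)) \<noteq> 0"
      then have "A \<in> D_set S" "moebius_poly A \<noteq> 0" by auto
      then obtain F where F: "finite F" "F \<subseteq> prime_polys" "A = \<Prod>F"
        by (auto simp: moebius_poly_def split: if_splits)
      then have "F \<in> ?X"
        using A \<open>A \<in> D_set S\<close> by (auto simp: D_set_def prod_primes_dvd_iff P_min_prod)
      then show False using A F by blast
    qed
    fix A assume "A \<in> (\<lambda>F. \<Prod>F) ` ?X"
    then obtain F where F: "A = \<Prod>F" "F \<in> ?X" by blast
    then have "A \<in> D_set S"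
      using sub[OF F(2)] by (auto simp: D_set_def P_min_prod monic_prod_primes)
    then show "of_bool (A \<in> D_set S) * (real_of_int (moebius_poly A) * real (Omega_deg A))
        = real_of_int (moebius_poly A) * real (Omega_deg A)" by simp
  qed
  also have "\<dots> = (\<Sum>F\<in>?X. (- 1) ^ card F * real (card (degree ` F)))"
    unfolding sum.reindex[OF inj] comp_def
    using sub by (intro sum.cong refl)
      (simp add: moebius_poly_prod Omega_deg_def prime_degrees_def prime_divisors_prod)
  also have "\<dots> = (\<Sum>P\<in>?R \<inter> S. of_bool (above (degree P) C = 1) - of_bool (above (degree P) C = 0))"
    unfolding above_def prime_degrees_def by (rule sum_subsets_unique_min[OF finR])
  finally show ?thesis .
qed

section \<open>Counting primes\<close>

text \<open>Pairs are kept instead of the powers so that \<open>degree P\<close> can be read off;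
  summing \<open>degree P\<close> over them plays the role of the von Mangoldt function.\<close>

definition prime_powers :: "('a::field poly \<times> nat) set" where
  "prime_powers = {(P, k). P \<in> prime_polys \<and> 1 \<le> k}"

lemma finite_prime_powers_degree_le:
  "finite {(P, k) \<in> (prime_powers :: ('a::{finite, field} poly \<times> nat) set). k * degree P \<le> n}"
proof (rule finite_subset)
  show "{(P, k) \<in> prime_powers. k * degree P \<le> n}
      \<subseteq> {P :: 'a poly. degree P \<le> n} \<times> {..n}"
  proof (rule subrelI)
    fix P :: "'a poly" and k
    assume "(P, k) \<in> {(P, k) \<in> prime_powers. k * degree P \<le> n}"
    then have *: "(P, k) \<in> prime_powers" "k * degree P \<le> n" by auto
    then have "0 < k" "0 < degree P" using prime_polysD(3) by (auto simp: prime_powers_def)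
    then have "k * 1 \<le> k * degree P" "1 * degree P \<le> k * degree P"
      by (intro mult_le_mono; simp)+
    then have "degree P \<le> n" "k \<le> n" using *(2) by linarith+
    then show "(P, k) \<in> {P. degree P \<le> n} \<times> {..n}" by simp
  qed
  show "finite ({P :: 'a poly. degree P \<le> n} \<times> {..n})"
    using finite_polys_degree_le by blast
qed

lemma prime_power_dvd_mult:
  assumes "P \<in> prime_polys" "Q \<in> prime_polys" "P \<noteq> Q"
  shows "P ^ k dvd Q * A \<longleftrightarrow> P ^ k dvd A"
proof
  assume "P ^ k dvd Q * A"
  then show "P ^ k dvd A"
  proof (induction k)
    case (Suc k)
    then have "P ^ k dvd A" using power_le_dvd[of P "Suc k" "Q * A" k] by simp
    then obtain B where B: "A = P ^ k * B" by (auto elim: dvdE)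
    have "P \<noteq> 0" using prime_polysD(1)[OF assms(1)] monic_poly_nonzero by auto
    moreover have "P ^ k * P dvd P ^ k * (Q * B)"
      using Suc.prems unfolding B by (simp add: ac_simps)
    ultimately have "P dvd Q * B" by simp
    then have "P dvd B" using prime_poly_dvd_mult[OF assms] by simp
    then show ?case
      unfolding B power_Suc2 by (rule mult_dvd_mono[OF dvd_refl])
  qed simp
qed simp

text \<open>The analogue of writing log n as the sum of the von Mangoldt function over the divisors
  of n. The induction splits off one prime factor \<open>P\<close> from \<open>A = P * B\<close>,
  which adds one prime power of degree weight \<open>degree P\<close>.\<close>

lemma degree_eq_sum_prime_powers:
  fixes A :: "'a::{finite, field} poly"
  assumes "monic_poly A"
  shows "degree A = (\<Sum>(P, k) | (P, k) \<in> prime_powers \<and> P ^ k dvd A. degree P)"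
  using assms
proof (induction "degree A" arbitrary: A rule: less_induct)
  case less
  let ?T = "\<lambda>A :: 'a poly. {(P, k). (P, k) \<in> prime_powers \<and> P ^ k dvd A}"
  have fin: "finite (?T A)" if "monic_poly A" for A
  proof (rule finite_subset[OF _ finite_prime_powers_degree_le[of "degree A"]])
    have "k * degree P \<le> degree A" if "P ^ k dvd A" "(P, k) \<in> prime_powers" for P k
    proof -
      have "P \<noteq> 0"
        using that prime_polysD(1) monic_poly_nonzero by (auto simp: prime_powers_def)
      then have "degree (P ^ k) = k * degree P" by (rule degree_power_eq)
      then show ?thesis
        using dvd_imp_degree_le[OF that(1)] monic_poly_nonzero[OF \<open>monic_poly A\<close>] by simp
    qed
    then show "?T A \<subseteq> {(P, k) \<in> prime_powers. k * degree P \<le> degree A}" by auto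
  qed
  show ?case
  proof (cases "A = 1")
    case True
    have "\<not> P ^ k dvd 1" if "(P, k) \<in> prime_powers" for P :: "'a poly" and k
      using that prime_elem_not_unit[OF prime_polysD(2)]
      by (auto simp: prime_powers_def is_unit_power_iff)
    then have "?T A = {}" using True by blast
    then show ?thesis using True by (simp only: sum.empty) simp
  next
    case False
    then obtain P where P: "P \<in> prime_polys" "P dvd A"
      using ex_prime_divisor less.prems by (auto simp: prime_divisors_def)
    then obtain B where A: "A = P * B" by (auto elim: dvdE)
    have nz: "P \<noteq> 0" using prime_polysD(1)[OF P(1)] monic_poly_nonzero by auto
    have B: "monic_poly B" "degree A = degree P + degree B"
      using less.prems prime_polysD(1)[OF P(1)]
      by (auto simp: A monic_poly_mult_iff degree_mult_monic)
    \<comment> \<open>Passing from \<open>B\<close> to \<open>P * B\<close> raises the exponents of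
      \<open>P\<close> by one and leaves the other primes alone. The pair \<open>(P, 1)\<close> is
      the only one not reached.\<close>
    let ?\<phi> = "\<lambda>(Q, k). (Q, if Q = P then Suc k else k)"
    have "bij_betw ?\<phi> (?T B) (?T A - {(P, 1)})"
      unfolding bij_betw_def
    proof
      show "inj_on ?\<phi> (?T B)" by (auto simp: inj_on_def split: if_splits)
      show "?\<phi> ` ?T B = ?T A - {(P, 1)}"
      proof (intro equalityI subsetI)
        fix x assume "x \<in> ?\<phi> ` ?T B"
        then obtain Q k where x: "x = ?\<phi> (Q, k)" "(Q, k) \<in> prime_powers" "Q ^ k dvd B" by auto
        then show "x \<in> ?T A - {(P, 1)}"
          by (cases "Q = P") (auto simp: A prime_powers_def)
      next
        fix x assume x: "x \<in> ?T A - {(P, 1)}"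
        obtain Q k where Qk: "x = (Q, k)" by (cases x)
        show "x \<in> ?\<phi> ` ?T B"
        proof (cases "Q = P")
          case True
          then have "1 \<le> k" "k \<noteq> 1" using x Qk by (auto simp: prime_powers_def)
          then obtain j where j: "k = Suc j" "1 \<le> j" by (cases k) auto
          then have "P ^ j dvd B" using x Qk True nz by (simp add: A)
          then have "(P, j) \<in> ?T B" using P j by (simp add: prime_powers_def)
          then show ?thesis using Qk True j by (intro image_eqI[of _ _ "(P, j)"]) simp_all
        next
          case False
          have "Q \<in> prime_polys" using x Qk by (simp add: prime_powers_def)
          then have "(Q, k) \<in> ?T B"
            using x Qk prime_power_dvd_mult[OF _ P(1) False] by (simp add: A)
          then show ?thesis using Qk False by (intro image_eqI[of _ _ "(Q, k)"]) simp_all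
        qed
      qed
    qed
    then have "(\<Sum>x\<in>?T A - {(P, 1)}. degree (fst x)) = (\<Sum>x\<in>?T B. degree (fst (?\<phi> x)))"
      by (rule sum.reindex_bij_betw[symmetric])
    also have "\<dots> = (\<Sum>(Q, k)\<in>?T B. degree Q)"
      by (intro sum.cong refl) auto
    also have "\<dots> = degree B"
      using less.hyps[of B] B prime_polysD(3)[OF P(1)] by simp
    finally have "(\<Sum>x\<in>?T A - {(P, 1)}. degree (fst x)) = degree B" .
    moreover have "(P, 1) \<in> ?T A" using P by (simp add: prime_powers_def)
    ultimately have "(\<Sum>x\<in>?T A. degree (fst x)) = degree P + degree B"
      using sum.remove[OF fin[OF less.prems], of "(P, 1)" "\<lambda>x. degree (fst x)"] by simp
    then show ?thesis using B(2) by (simp add: case_prod_unfold)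
  qed
qed

text \<open>Both sides are the mean of the degree, computed by factoring.\<close>

lemma sum_prime_powers_degree_le:
  "(\<Sum>(P, k) | (P, k) \<in> prime_powers \<and> k * degree P \<le> n.
      real (degree P) / real CARD('a) ^ (k * degree (P :: 'a::{finite, field} poly))) = real n"
proof -
  let ?T = "{(P :: 'a poly, k). (P, k) \<in> prime_powers \<and> k * degree P \<le> n}"
  have deg_pow: "degree (P ^ k) = k * degree P" "monic_poly (P ^ k)"
    if "(P, k) \<in> prime_powers" for P :: "'a poly" and k
  proof -
    have "monic_poly P" using that prime_polysD(1) by (auto simp: prime_powers_def)
    then show "degree (P ^ k) = k * degree P" "monic_poly (P ^ k)"
      using degree_power_eq[OF monic_poly_nonzero] by (auto simp: monic_poly_def lead_coeff_power)
  qed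
  have "real n = mean n (\<lambda>A :: 'a poly. real n)" by (simp add: mean_const)
  also have "\<dots> = mean n (\<lambda>A :: 'a poly. \<Sum>x\<in>?T. real (degree (fst x)) * of_bool (fst x ^ snd x dvd A))"
  proof (rule mean_cong)
    fix A :: "'a poly" assume "A \<in> monics n"
    then have A: "monic_poly A" "degree A = n" by (auto simp: monics_def)
    let ?TA = "{(P, k). (P, k) \<in> prime_powers \<and> P ^ k dvd A}"
    have "?TA \<subseteq> ?T"
    proof clarify
      fix P k assume *: "(P, k) \<in> prime_powers" "P ^ k dvd A"
      then show "k * degree P \<le> n"
        using dvd_imp_degree_le[OF *(2)] monic_poly_nonzero[OF A(1)] A(2) deg_pow[OF *(1)] by simp
    qed
    have "real n = (\<Sum>x\<in>?TA. real (degree (fst x)))"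
      using degree_eq_sum_prime_powers[OF A(1)] A(2) by (simp add: case_prod_unfold)
    also have "\<dots> = (\<Sum>x\<in>?T. real (degree (fst x)) * of_bool (fst x ^ snd x dvd A))"
      using \<open>?TA \<subseteq> ?T\<close> finite_prime_powers_degree_le[of n, where 'a = 'a]
      by (intro sum.mono_neutral_cong_left) (auto simp: case_prod_unfold)
    finally show "real n = (\<Sum>x\<in>?T. real (degree (fst x)) * of_bool (fst x ^ snd x dvd A))" .
  qed
  also have "\<dots> = (\<Sum>x\<in>?T. real (degree (fst x)) / real CARD('a) ^ (snd x * degree (fst x)))"
    unfolding mean_sum mean_cmult
    by (intro sum.cong refl) (auto simp: mean_of_bool_dvd deg_pow)
  finally show ?thesis by (simp add: case_prod_unfold)
qed

text \<open>Gauss's formula: the sum of \<open>d * \<pi>(d)\<close> over the divisors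
  \<open>d\<close> of \<open>n\<close> is \<open>q ^ n\<close>. It is the difference of
  \<open>sum_prime_powers_degree_le\<close> at \<open>n\<close> and \<open>n - 1\<close>, in which
  all denominators equal \<open>q ^ n\<close>.\<close>

lemma sum_prime_powers_degree_eq:
  assumes "1 \<le> n"
  shows "(\<Sum>(P, k) | (P, k) \<in> prime_powers \<and> k * degree P = n. degree (P :: 'a::{finite, field} poly))
    = CARD('a) ^ n"
proof -
  obtain m where n: "n = Suc m" using assms by (cases n) auto
  let ?T = "\<lambda>n. {(P :: 'a poly, k). (P, k) \<in> prime_powers \<and> k * degree P \<le> n}"
  let ?E = "{(P :: 'a poly, k). (P, k) \<in> prime_powers \<and> k * degree P = n}"
  let ?f = "\<lambda>(P :: 'a poly, k). real (degree P) / real CARD('a) ^ (k * degree P)"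
  have fin: "finite (?T n)"
    using finite_prime_powers_degree_le[of n, where 'a = 'a] by (simp add: case_prod_unfold)
  have "?E = ?T n - ?T m" by (auto simp: n)
  then have "(\<Sum>x\<in>?E. ?f x) = (\<Sum>x\<in>?T n. ?f x) - (\<Sum>x\<in>?T m. ?f x)"
    using fin by (simp add: sum_diff n) (subst sum_diff; auto)
  also have "\<dots> = 1"
    unfolding sum_prime_powers_degree_le n by simp
  finally have "(\<Sum>x\<in>?E. ?f x) = 1" .
  moreover have "(\<Sum>x\<in>?E. ?f x) = (\<Sum>x\<in>?E. real (degree (fst x))) / real CARD('a) ^ n"
    unfolding sum_divide_distrib by (intro sum.cong) auto
  ultimately have "(\<Sum>x\<in>?E. real (degree (fst x))) = real CARD('a) ^ n"
    by (simp add: field_simps)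
  then have "real (\<Sum>x\<in>?E. degree (fst x)) = real (CARD('a) ^ n)" by simp
  then show ?thesis unfolding of_nat_eq_iff by (simp add: case_prod_unfold)
qed

text \<open>The pairs with exponent 1 alone contribute the left side to Gauss's formula.\<close>

lemma prime_count_upper:
  assumes "1 \<le> n"
  shows "n * deg_count (prime_polys :: 'a::{finite, field} poly set) n \<le> CARD('a) ^ n"
proof -
  let ?P = "{P \<in> (prime_polys :: 'a poly set). degree P = n}"
  let ?E = "{(P :: 'a poly, k). (P, k) \<in> prime_powers \<and> k * degree P = n}"
  have fin: "finite ?E"
    by (rule finite_subset[OF _ finite_prime_powers_degree_le[of n]]) auto
  have "n * deg_count (prime_polys :: 'a poly set) n = (\<Sum>P\<in>?P. degree P)"
    by (simp add: deg_count_def)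
  also have "\<dots> = (\<Sum>x\<in>(\<lambda>P. (P, 1 :: nat)) ` ?P. degree (fst x))"
    by (subst sum.reindex) (auto simp: inj_on_def)
  also have "\<dots> \<le> (\<Sum>x\<in>?E. degree (fst x))"
    using fin by (intro sum_mono2) (auto simp: prime_powers_def)
  also have "\<dots> = CARD('a) ^ n"
    using sum_prime_powers_degree_eq[OF assms, where 'a = 'a] by (simp add: case_prod_unfold)
  finally show ?thesis .
qed

text \<open>The values lie in a general semiring because \<open>prime_count_lower\<close> sums
  natural numbers, while the later estimates sum reals.\<close>

lemma sum_by_degree:
  fixes g :: "nat \<Rightarrow> 'b::semiring_1"
  assumes "T \<subseteq> (prime_polys :: 'a::{finite, field} poly set)"
  shows "(\<Sum>P | P \<in> T \<and> degree P \<in> I \<and> degree P \<le> n. g (degree P))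
    = (\<Sum>d\<in>I \<inter> {..n}. of_nat (deg_count T d) * g d)"
proof -
  let ?X = "{P. P \<in> T \<and> degree P \<in> I \<and> degree P \<le> n}"
  have "finite ?X"
    by (rule finite_subset[OF _ finite_polys_degree_le[of n]]) auto
  then have "(\<Sum>P\<in>?X. g (degree P)) = (\<Sum>d\<in>I \<inter> {..n}. \<Sum>P | P \<in> ?X \<and> degree P = d. g (degree P))"
    by (intro sum.group[symmetric]) auto
  also have "\<dots> = (\<Sum>d\<in>I \<inter> {..n}. \<Sum>P | P \<in> T \<and> degree P = d. g d)"
    by (intro sum.cong) auto
  finally show ?thesis by (simp add: deg_count_def)
qed

lemma sum_powers_le:
  fixes q :: nat
  assumes "2 \<le> q"
  shows "(\<Sum>d\<le>m. q ^ d) \<le> 2 * q ^ m"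
proof (induction m)
  case (Suc m)
  have "2 * q ^ m \<le> q * q ^ m" using assms by (rule mult_right_mono) simp
  then show ?case using Suc by (simp, linarith)
qed simp

text \<open>In Gauss's formula the exponents \<open>k \<ge> 2\<close> involve only primes of degree
  at most \<open>n div 2\<close>. By \<open>prime_count_upper\<close> these contribute at most
  \<open>2 * q ^ (n div 2)\<close>, which is at most half of \<open>q ^ n\<close>.\<close>

lemma prime_count_lower:
  assumes "4 \<le> n"
  shows "CARD('a) ^ n \<le> 2 * n * deg_count (prime_polys :: 'a::{finite, field} poly set) n"
proof -
  let ?q = "CARD('a)" and ?m = "n div 2"
  let ?\<pi> = "deg_count (prime_polys :: 'a poly set)"
  let ?P = "{P \<in> (prime_polys :: 'a poly set). degree P = n}"
  let ?L = "{P \<in> (prime_polys :: 'a poly set). degree P \<le> ?m}"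
  let ?E = "{(P :: 'a poly, k). (P, k) \<in> prime_powers \<and> k * degree P = n}"
  \<comment> \<open>Since \<open>k * degree P = n\<close> with \<open>degree P > 0\<close>, the
    prime determines the exponent, so the sum over pairs is a sum over primes.\<close>
  have inj: "inj_on fst ?E"
  proof (rule inj_onI)
    fix x y :: "'a poly \<times> nat"
    assume *: "x \<in> ?E" "y \<in> ?E" "fst x = fst y"
    then have "0 < degree (fst x)"
      using prime_polysD(3)[of "fst x"] by (auto simp: prime_powers_def)
    moreover have "snd x * degree (fst x) = snd y * degree (fst x)" using * by auto
    ultimately show "x = y" using *(3) by (simp add: prod_eq_iff)
  qed
  have sub: "fst ` ?E \<subseteq> ?P \<union> ?L"
  proof (rule image_subsetI)
    fix x assume "x \<in> ?E"
    then obtain P k where x: "x = (P, k)" "P \<in> prime_polys" "1 \<le> k" "k * degree P = n"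
      by (auto simp: prime_powers_def)
    show "fst x \<in> ?P \<union> ?L"
    proof (cases "k = 1")
      case False
      then have "2 * degree P \<le> n" using x mult_le_mono1[of 2 k "degree P"] by simp
      then have "degree P \<le> n div 2" by linarith
      then show ?thesis using x by simp
    qed (use x in simp)
  qed
  have "?q ^ n = (\<Sum>x\<in>?E. degree (fst x))"
    using sum_prime_powers_degree_eq[of n, where 'a = 'a] assms by (simp add: case_prod_unfold)
  also have "\<dots> = (\<Sum>P\<in>fst ` ?E. degree P)"
    using inj by (simp add: sum.reindex)
  also have "\<dots> \<le> (\<Sum>P\<in>?P \<union> ?L. degree P)"
    using sub by (intro sum_mono2) auto
  also have "\<dots> \<le> (\<Sum>P\<in>?P. degree P) + (\<Sum>P\<in>?L. degree P)"
    by (subst sum.union_inter[symmetric]) auto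
  also have "(\<Sum>P\<in>?P. degree P) = n * ?\<pi> n"
    by (simp add: deg_count_def)
  also have "(\<Sum>P\<in>?L. degree P) = (\<Sum>d\<le>?m. ?\<pi> d * d)"
    using sum_by_degree[of "prime_polys :: 'a poly set" "\<lambda>d. d" UNIV ?m] by simp
  also have "\<dots> \<le> (\<Sum>d\<le>?m. ?q ^ d)"
  proof (rule sum_mono)
    fix d
    show "?\<pi> d * d \<le> ?q ^ d"
      using prime_count_upper[of d, where 'a = 'a] by (cases "d = 0") (auto simp: mult.commute)
  qed
  also have "\<dots> \<le> 2 * ?q ^ ?m" by (rule sum_powers_le[OF card_field_ge_2])
  finally have 1: "?q ^ n \<le> n * ?\<pi> n + 2 * ?q ^ ?m" by simp
  \<comment> \<open>Here \<open>4 \<le> n\<close> enters: it gives \<open>n div 2 \<ge> 2\<close>,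
    so the error \<open>2 * q ^ (n div 2)\<close> is at most \<open>q ^ n / 2\<close>.\<close>
  have "4 \<le> ?q ^ 2" using power_mono[OF card_field_ge_2[where 'a = 'a], of 2] by simp
  also have "\<dots> \<le> ?q ^ ?m"
    using assms card_field_ge_2[where 'a = 'a] by (intro power_increasing) auto
  finally have "4 * ?q ^ ?m \<le> ?q ^ ?m * ?q ^ ?m" by simp
  also have "\<dots> \<le> ?q ^ n"
    unfolding power_add[symmetric] using card_field_ge_2[where 'a = 'a]
    by (intro power_increasing) auto
  finally show ?thesis using 1 by linarith
qed

text \<open>By \<open>prime_count_lower\<close> the terms are at least \<open>1 / (2 * m)\<close>
  for \<open>m \<ge> 4\<close>, so bounded partial sums would make the harmonic series
  converge.\<close>

lemma sum_prime_density_unbounded: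
  "\<exists>e>d. K \<le> (\<Sum>m\<in>{d<..e}. real (deg_count (prime_polys :: 'a::{finite, field} poly set) m) / real CARD('a) ^ m)"
proof (rule ccontr)
  let ?x = "\<lambda>m. real (deg_count (prime_polys :: 'a poly set) m) / real CARD('a) ^ m"
  assume neg: "\<not> ?thesis"
  have "summable ?x"
  proof (rule summableI_nonneg_bounded)
    fix n
    have "(\<Sum>m<n. ?x m) \<le> (\<Sum>m\<in>{..d} \<union> {d<..d + n + 1}. ?x m)"
      by (rule sum_mono2) auto
    also have "\<dots> = (\<Sum>m\<le>d. ?x m) + (\<Sum>m\<in>{d<..d + n + 1}. ?x m)"
      by (rule sum.union_disjoint) auto
    also have "(\<Sum>m\<in>{d<..d + n + 1}. ?x m) \<le> K"
      using neg by (metis add.assoc less_add_same_cancel1 add_gr_0 linear zero_less_one)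
    finally show "(\<Sum>m<n. ?x m) \<le> (\<Sum>m\<le>d. ?x m) + K" by simp
  qed simp
  then have "summable (\<lambda>m. 2 * ?x m)" by (rule summable_mult)
  moreover have "norm (inverse (real m)) \<le> 2 * ?x m" if "4 \<le> m" for m
  proof -
    have "real (CARD('a) ^ m) \<le> real (2 * m * deg_count (prime_polys :: 'a poly set) m)"
      using prime_count_lower[OF that, where 'a = 'a] by (rule of_nat_mono)
    then show ?thesis using that by (simp add: field_simps)
  qed
  ultimately have "summable (\<lambda>m. inverse (real m))"
    by (rule summable_comparison_test'[where N = 4])
  then show False using not_summable_harmonic by blast
qed

section \<open>Polynomials whose prime divisors have few large degrees\<close>

text \<open>Once \<open>n\<close> is at least the total degree of \<open>F\<close>, divisibility by
  the different primes behaves as exactly independent events. Those \<open>A\<close> divisible by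
  \<open>Q\<close> are written \<open>Q * A'\<close>, and \<open>n - degree Q\<close> is still large
  enough for the induction hypothesis on the remaining primes.\<close>

lemma mean_no_prime_dvd:
  fixes F :: "'a::{finite, field} poly set"
  assumes "finite F" "F \<subseteq> prime_polys" "(\<Sum>P\<in>F. degree P) \<le> n"
  shows "mean n (\<lambda>A. of_bool (\<forall>P\<in>F. \<not> P dvd A)) = (\<Prod>P\<in>F. 1 - 1 / real CARD('a) ^ degree P)"
  using assms
proof (induction F arbitrary: n rule: finite_induct)
  case (insert Q F)
  have Q: "Q \<in> prime_polys" "degree Q \<le> n" "(\<Sum>P\<in>F. degree P) \<le> n - degree Q"
    using insert.prems insert.hyps by auto
  have "mean n (\<lambda>A. of_bool (\<forall>P\<in>insert Q F. \<not> P dvd A))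
      = mean n (\<lambda>A. of_bool (\<forall>P\<in>F. \<not> P dvd A) - of_bool (Q dvd A) * of_bool (\<forall>P\<in>F. \<not> P dvd A))"
    by (rule mean_cong) (simp add: of_bool_def)
  also have "\<dots> = mean n (\<lambda>A. of_bool (\<forall>P\<in>F. \<not> P dvd A))
      - mean (n - degree Q) (\<lambda>A. of_bool (\<forall>P\<in>F. \<not> P dvd Q * A)) / real CARD('a) ^ degree Q"
    unfolding mean_diff using Q by (subst mean_dvd) (auto dest: prime_polysD)
  also have "(\<lambda>A. of_bool (\<forall>P\<in>F. \<not> P dvd Q * A)) = (\<lambda>A. of_bool (\<forall>P\<in>F. \<not> P dvd A) :: real)"
  proof
    fix A
    have "P dvd Q * A \<longleftrightarrow> P dvd A" if "P \<in> F" for P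
      using that insert.prems insert.hyps by (intro prime_poly_dvd_mult) auto
    then show "of_bool (\<forall>P\<in>F. \<not> P dvd Q * A) = (of_bool (\<forall>P\<in>F. \<not> P dvd A) :: real)" by simp
  qed
  finally show ?case
    using insert Q by (simp add: algebra_simps)
qed (simp add: mean_const)

lemma finite_prime_degrees:
  fixes A :: "'a::{finite, field} poly"
  shows "A \<noteq> 0 \<Longrightarrow> finite (prime_degrees A)"
  unfolding prime_degrees_def by (intro finite_imageI finite_prime_divisors)

text \<open>The sieve product of \<open>mean_no_prime_dvd\<close> is bounded factor by factor
  through \<open>1 - x \<le> exp (- x)\<close>. The bound starts when \<open>n\<close> reaches the
  total degree of the primes in the window.\<close>

lemma eventually_mean_no_prime_degree_le:
  "\<forall>\<^sub>F n in sequentially. mean n (\<lambda>A :: 'a::{finite, field} poly. of_bool (prime_degrees A \<inter> {d<..e} = {}))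
    \<le> exp (- (\<Sum>m\<in>{d<..e}. real (deg_count (prime_polys :: 'a poly set) m) / real CARD('a) ^ m))"
proof -
  let ?q = "real CARD('a)"
  let ?F = "{P. P \<in> (prime_polys :: 'a poly set) \<and> degree P \<in> {d<..e} \<and> degree P \<le> e}"
  have F: "finite ?F" "?F \<subseteq> prime_polys"
    by (auto intro: finite_subset[OF _ finite_polys_degree_le[of e]])
  have q: "1 / ?q ^ m \<le> 1" for m
    using card_field_ge_2[where 'a = 'a] by (simp add: one_le_power)
  have "mean n (\<lambda>A :: 'a poly. of_bool (prime_degrees A \<inter> {d<..e} = {}))
      \<le> exp (- (\<Sum>m\<in>{d<..e}. real (deg_count (prime_polys :: 'a poly set) m) / ?q ^ m))"
    if n: "(\<Sum>P\<in>?F. degree P) \<le> n" for n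
  proof -
    have "(\<lambda>A :: 'a poly. of_bool (prime_degrees A \<inter> {d<..e} = {}))
        = (\<lambda>A. of_bool (\<forall>P\<in>?F. \<not> P dvd A) :: real)"
      by (intro ext arg_cong[of _ _ of_bool]) (auto simp: prime_degrees_def prime_divisors_def)
    then have "mean n (\<lambda>A :: 'a poly. of_bool (prime_degrees A \<inter> {d<..e} = {}))
        = (\<Prod>P\<in>?F. 1 - 1 / ?q ^ degree P)"
      using mean_no_prime_dvd[OF F n] by simp
    also have "\<dots> \<le> (\<Prod>P\<in>?F. exp (- (1 / ?q ^ degree P)))"
    proof (rule prod_mono)
      fix P
      show "0 \<le> 1 - 1 / ?q ^ degree P \<and> 1 - 1 / ?q ^ degree P \<le> exp (- (1 / ?q ^ degree P))"
        using q[of "degree P"] exp_ge_add_one_self[of "- (1 / ?q ^ degree P)"] by simp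
    qed
    also have "\<dots> = exp (- (\<Sum>P\<in>?F. 1 / ?q ^ degree P))"
      using F(1) by (simp add: exp_sum sum_negf flip: sum_negf)
    also have "(\<Sum>P\<in>?F. 1 / ?q ^ degree P)
        = (\<Sum>m\<in>{d<..e} \<inter> {..e}. real (deg_count (prime_polys :: 'a poly set) m) * (1 / ?q ^ m))"
      by (rule sum_by_degree) simp
    also have "{d<..e} \<inter> {..e} = {d<..e}" by auto
    finally show ?thesis by simp
  qed
  then show ?thesis by (rule eventually_sequentiallyI)
qed

text \<open>Induction on \<open>i\<close> with \<open>d\<close> free. A window
  \<open>{d<..e}\<close> is chosen so that few polynomials have no prime degree in it; for all
  others a degree in the window counts above \<open>d\<close> but not above \<open>e\<close>, so
  fewer than \<open>Suc i\<close> degrees above \<open>d\<close> means fewer than \<open>i\<close>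
  above \<open>e\<close>.\<close>

lemma tendsto_mean_above_less:
  "(\<lambda>n. mean n (\<lambda>A :: 'a::{finite, field} poly. of_bool (above d A < i))) \<longlonglongrightarrow> 0"
proof (induction i arbitrary: d)
  case 0
  then show ?case by (simp add: mean_const)
next
  case (Suc i)
  show ?case
  proof (rule tendstoI)
    fix \<epsilon> :: real assume "0 < \<epsilon>"
    let ?\<pi> = "deg_count (prime_polys :: 'a poly set)"
    \<comment> \<open>The threshold \<open>- ln (\<epsilon> / 2)\<close> is what turns the
      exponential sieve bound into \<open>\<epsilon> / 2\<close>.\<close>
    obtain e where e: "- ln (\<epsilon> / 2) \<le> (\<Sum>m\<in>{d<..e}. real (?\<pi> m) / real CARD('a) ^ m)"
      using sum_prime_density_unbounded by blast
    then have "exp (- (\<Sum>m\<in>{d<..e}. real (?\<pi> m) / real CARD('a) ^ m)) \<le> exp (ln (\<epsilon> / 2))"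
      by simp
    then have e: "exp (- (\<Sum>m\<in>{d<..e}. real (?\<pi> m) / real CARD('a) ^ m)) \<le> \<epsilon> / 2"
      using \<open>0 < \<epsilon>\<close> by simp
    have "\<forall>\<^sub>F n in sequentially. mean n (\<lambda>A :: 'a poly. of_bool (above e A < i)) < \<epsilon> / 2"
      using Suc[of e] \<open>0 < \<epsilon>\<close> by (intro order_tendstoD(2)) auto
    then show "\<forall>\<^sub>F n in sequentially.
        dist (mean n (\<lambda>A :: 'a poly. of_bool (above d A < Suc i))) 0 < \<epsilon>"
      using eventually_mean_no_prime_degree_le[of d e, where 'a = 'a]
    proof eventually_elim
      case (elim n)
      have "mean n (\<lambda>A :: 'a poly. of_bool (above d A < Suc i))
          \<le> mean n (\<lambda>A :: 'a poly. of_bool (prime_degrees A \<inter> {d<..e} = {}) + of_bool (above e A < i))"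
      proof (rule mean_mono)
        fix A :: "'a poly" assume "A \<in> monics n"
        then have fin: "finite (prime_degrees A)"
          by (rule finite_prime_degrees[OF monics_nonzero])
        have "above e A < above d A" if "m \<in> prime_degrees A" "d < m" "m \<le> e" for m
          unfolding above_def
        proof (rule psubset_card_mono)
          show "finite {l \<in> prime_degrees A. d < l}" using fin by simp
          have "m \<notin> {l \<in> prime_degrees A. e < l}" "m \<in> {l \<in> prime_degrees A. d < l}"
            using that by simp_all
          moreover have "{l \<in> prime_degrees A. e < l} \<subseteq> {l \<in> prime_degrees A. d < l}"
            using that by auto
          ultimately show "{l \<in> prime_degrees A. e < l} \<subset> {l \<in> prime_degrees A. d < l}"
            by blast
        qed
        then have "above e A < i" if "above d A < Suc i" "prime_degrees A \<inter> {d<..e} \<noteq> {}"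
          using that by fastforce
        then show "of_bool (above d A < Suc i)
            \<le> (of_bool (prime_degrees A \<inter> {d<..e} = {}) + of_bool (above e A < i) :: real)"
          by auto
      qed
      also have "\<dots> < \<epsilon>" unfolding mean_add using elim e by linarith
      finally show ?case using mean_nonneg[of n "\<lambda>A :: 'a poly. of_bool (above d A < Suc i)"] by simp
    qed
  qed
qed

section \<open>Primes of a given rank\<close>

text \<open>It counts primes and not degrees, so several primes of the same degree make it exceed 1.
  Index 0 refers to the largest prime degree of \<open>C\<close>, index 1 to the second
  largest.\<close>

definition rank_count :: "nat \<Rightarrow> 'a::field poly set \<Rightarrow> 'a poly \<Rightarrow> nat" where
  "rank_count i T C = card {P \<in> prime_divisors C \<inter> T. above (degree P) C = i}"

text \<open>The factor \<open>P\<close> can add only its own degree, which does not exceed itself.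
  Hence the rank condition on \<open>P\<close> survives cancelling \<open>P\<close>.\<close>

lemma above_mult:
  assumes "P \<in> prime_polys"
  shows "above (degree P) (P * A) = above (degree P) A"
proof -
  have "{m \<in> prime_degrees (P * A). degree P < m} = {m \<in> prime_degrees A. degree P < m}"
    using prime_divisors_mult[OF assms] by (auto simp: prime_degrees_def)
  then show ?thesis by (simp add: above_def)
qed

lemma degree_prime_divisor_le:
  assumes "C \<in> monics n" "P \<in> prime_divisors C"
  shows "degree P \<le> n"
  using dvd_imp_degree_le[of P C] assms monics_nonzero[OF assms(1)]
  by (auto simp: monics_def prime_divisors_def)

text \<open>After \<open>P\<close> is divided out of \<open>C\<close>, the rank condition on the
  cofactor depends on \<open>P\<close> only through its degree. So \<open>T\<close> enters only
  through \<open>deg_count T\<close>, with weights common to all \<open>T\<close>; this is what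
  permits comparing \<open>S\<close> with the set of all primes.\<close>

lemma mean_rank_count:
  assumes "T \<subseteq> (prime_polys :: 'a::{finite, field} poly set)"
  shows "mean n (\<lambda>C. real (rank_count i T C))
    = (\<Sum>d\<le>n. real (deg_count T d)
        * (mean (n - d) (\<lambda>A :: 'a poly. of_bool (above d A = i)) / real CARD('a) ^ d))"
proof -
  let ?X = "{P. P \<in> T \<and> degree P \<in> UNIV \<and> degree P \<le> n}"
  have fin: "finite ?X"
    by (rule finite_subset[OF _ finite_polys_degree_le[of n]]) auto
  have "mean n (\<lambda>C. real (rank_count i T C))
      = mean n (\<lambda>C. \<Sum>P\<in>?X. of_bool (P dvd C) * of_bool (above (degree P) C = i))"
  proof (rule mean_cong)
    fix C :: "'a poly" assume C: "C \<in> monics n"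
    have "{P \<in> prime_divisors C \<inter> T. above (degree P) C = i}
        = ?X \<inter> {P. P dvd C \<and> above (degree P) C = i}"
      using degree_prime_divisor_le[OF C] assms by (auto simp: prime_divisors_def)
    then show "real (rank_count i T C)
        = (\<Sum>P\<in>?X. of_bool (P dvd C) * of_bool (above (degree P) C = i))"
      using fin by (simp add: rank_count_def flip: of_bool_conj)
  qed
  also have "\<dots> = (\<Sum>P\<in>?X. mean (n - degree P) (\<lambda>A :: 'a poly. of_bool (above (degree P) A = i))
      / real CARD('a) ^ degree P)"
    unfolding mean_sum
  proof (rule sum.cong)
    fix P assume P: "P \<in> ?X"
    then have "P \<in> prime_polys" using assms by auto
    then show "mean n (\<lambda>C. of_bool (P dvd C) * of_bool (above (degree P) C = i))
        = mean (n - degree P) (\<lambda>A :: 'a poly. of_bool (above (degree P) A = i))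
          / real CARD('a) ^ degree P"
      using P prime_polysD(1) by (subst mean_dvd) (simp_all add: above_mult)
  qed simp
  also have "\<dots> = (\<Sum>d\<in>UNIV \<inter> {..n}. of_nat (deg_count T d)
      * (mean (n - d) (\<lambda>A :: 'a poly. of_bool (above d A = i)) / real CARD('a) ^ d))"
    by (rule sum_by_degree[OF assms])
  finally show ?thesis by simp
qed

section \<open>The mean rank count for the set of all primes\<close>

text \<open>The number of larger elements is strictly decreasing on \<open>M\<close>, hence a
  bijection onto \<open>{..<card M}\<close>, and some unique \<open>m\<close> has rank
  \<open>i\<close>. If \<open>m \<le> d\<close>, more than \<open>i\<close> elements would lie above
  it.\<close>

lemma ex1_card_greater_eq:
  fixes M :: "nat set"
  assumes "finite M" "i < card {m \<in> M. d < m}"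
  shows "\<exists>m\<in>M. d < m \<and> (\<forall>l\<in>M. card {m' \<in> M. l < m'} = i \<longleftrightarrow> l = m)"
proof -
  let ?g = "\<lambda>l. card {m' \<in> M. l < m'}"
  have less: "?g l < ?g k" if "k \<in> M" "l \<in> M" "k < l" for k l
    using that assms(1) by (intro psubset_card_mono psubsetI) auto
  have inj: "inj_on ?g M"
  proof (rule inj_onI)
    fix k l assume "k \<in> M" "l \<in> M" "?g k = ?g l"
    then show "k = l" using less[of k l] less[of l k] by (cases k l rule: linorder_cases) auto
  qed
  have "?g ` M \<subseteq> {..<card M}"
  proof (rule image_subsetI)
    fix l assume "l \<in> M"
    then have "?g l < card M"
      using assms(1) by (intro psubset_card_mono psubsetI) auto
    then show "?g l \<in> {..<card M}" by simp
  qed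
  then have "?g ` M = {..<card M}"
    using inj by (intro card_subset_eq) (auto simp: card_image)
  moreover have "i < card M"
    using assms card_mono[of M "{m \<in> M. d < m}"] by auto
  ultimately have "i \<in> ?g ` M" by (simp only: lessThan_iff)
  then obtain m where m: "m \<in> M" "?g m = i" by blast
  have "d < m"
  proof (rule ccontr)
    assume "\<not> d < m"
    then have "card {l \<in> M. d < l} \<le> ?g m" using assms(1) by (intro card_mono) auto
    then show False using assms(2) m(2) by simp
  qed
  moreover have "?g l = i \<longleftrightarrow> l = m" if "l \<in> M" for l
    using inj_onD[OF inj, of l m] that m by auto
  ultimately show ?thesis using m(1) by blast
qed

text \<open>The pairs are ordered, so each coincidence of degrees counts twice; only upper bounds
  are drawn from their number.\<close>

definition close_pairs :: "nat \<Rightarrow> 'a::field poly \<Rightarrow> ('a poly \<times> 'a poly) set" where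
  "close_pairs d C = {(P, Q). P \<in> prime_divisors C \<and> Q \<in> prime_divisors C \<and> P \<noteq> Q
    \<and> degree P = degree Q \<and> d < degree P}"

text \<open>A count of \<open>k \<ge> 1\<close> primes of equal degree leaves an excess \<open>k - 1\<close>, at most the number of pairs.\<close>

lemma abs_rank_count_minus_1_le:
  fixes C :: "'a::{finite, field} poly"
  assumes "C \<noteq> 0"
  shows "\<bar>real (rank_count i prime_polys C) - 1\<bar>
    \<le> (real (card {P \<in> (prime_polys :: 'a poly set). degree P \<le> d}) + 1) * of_bool (above d C < Suc i)
      + real (card (close_pairs d C))"
proof (cases "above d C < Suc i")
  case True
  \<comment> \<open>With at most \<open>i\<close> prime degrees above \<open>d\<close>, a prime of
    rank \<open>i\<close> cannot have degree above \<open>d\<close>. The count is then bounded by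
    the number of all primes of degree at most \<open>d\<close>, and the extra 1 absorbs the
    subtracted 1.\<close>
  have "degree P \<le> d" if P: "P \<in> prime_divisors C" "above (degree P) C = i" for P
  proof (rule ccontr)
    assume "\<not> degree P \<le> d"
    then have "{m \<in> prime_degrees C. degree P < m} \<subset> {m \<in> prime_degrees C. d < m}"
      using P(1) by (intro psubsetI) (auto simp: prime_degrees_def)
    then have "above (degree P) C < above d C"
      unfolding above_def using finite_prime_degrees[OF assms] by (intro psubset_card_mono) simp_all
    then show False using True P(2) by simp
  qed
  then have "rank_count i prime_polys C \<le> card {P \<in> (prime_polys :: 'a poly set). degree P \<le> d}"
    unfolding rank_count_def by (intro card_mono) auto
  then show ?thesis using True by simp
next
  case False
  let ?R = "prime_divisors C"
  have finR: "finite ?R" by (rule finite_prime_divisors[OF assms])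
  obtain m where m: "m \<in> prime_degrees C" "d < m"
    "\<And>l. l \<in> prime_degrees C \<Longrightarrow> above l C = i \<longleftrightarrow> l = m"
    using ex1_card_greater_eq[OF finite_prime_degrees[OF assms], of i d] False
    by (auto simp: above_def not_less Suc_le_eq)
  let ?Z = "{P \<in> ?R. degree P = m}"
  have "{P \<in> ?R \<inter> prime_polys. above (degree P) C = i} = ?Z"
    using m(3) by (auto simp: prime_divisors_def prime_degrees_def)
  then have r: "rank_count i prime_polys C = card ?Z" by (simp add: rank_count_def)
  obtain P where P: "P \<in> ?Z" using m(1) by (auto simp: prime_degrees_def)
  \<comment> \<open>Pairing one fixed \<open>P\<close> with the other primes of degree
    \<open>m\<close> already accounts for the excess \<open>card ?Z - 1\<close>.\<close>
  have "card ((\<lambda>Q. (P, Q)) ` (?Z - {P})) \<le> card (close_pairs d C)"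
  proof (rule card_mono)
    show "finite (close_pairs d C)"
      by (rule finite_subset[OF _ finite_cartesian_product[OF finR finR]])
         (auto simp: close_pairs_def)
    show "(\<lambda>Q. (P, Q)) ` (?Z - {P}) \<subseteq> close_pairs d C"
      using P m(2) by (auto simp: close_pairs_def)
  qed
  moreover have "card ((\<lambda>Q. (P, Q)) ` (?Z - {P})) = card (?Z - {P})"
    by (rule card_image) (auto simp: inj_on_def)
  moreover have "card ?Z = Suc (card (?Z - {P}))"
    using finR P by (subst card.remove[of _ P]) auto
  ultimately show ?thesis using False by (simp add: r)
qed

text \<open>Telescoping with \<open>1 / (n + 1) ^ 2 \<le> 1 / n - 1 / (n + 1)\<close>; the induction
  carries the sharper bound \<open>1 / d - 1 / n\<close>.\<close>

lemma sum_inverse_squares_le: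
  assumes "1 \<le> d"
  shows "(\<Sum>m\<in>{d<..n}. 1 / real m ^ 2) \<le> 1 / real d"
proof -
  have "(\<Sum>m\<in>{d<..n}. 1 / real m ^ 2) \<le> 1 / real d - 1 / real n" if "d \<le> n"
    using that
  proof (induction n rule: dec_induct)
    case (step n)
    have "{d<..Suc n} = insert (Suc n) {d<..n}" using step by auto
    moreover have "1 / real (Suc n) ^ 2 \<le> 1 / real n - 1 / real (Suc n)"
    proof -
      have "1 / real (Suc n) ^ 2 \<le> 1 / (real n * real (Suc n))"
        using step assms unfolding power2_eq_square
        by (intro divide_left_mono mult_right_mono mult_pos_pos) auto
      also have "\<dots> = 1 / real n - 1 / real (Suc n)"
        using step assms by (simp add: field_simps)
      finally show ?thesis .
    qed
    ultimately show ?case using step by simp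
  qed simp
  then show ?thesis by (cases "d \<le> n") (auto intro: order_trans)
qed

text \<open>A pair of distinct primes of degree \<open>m\<close> divides with probability at most
  \<open>1 / q ^ (2 * m)\<close>, and there are at most \<open>\<pi>(m) ^ 2\<close> such pairs, so
  degree \<open>m\<close> contributes at most \<open>1 / m ^ 2\<close> by
  \<open>prime_count_upper\<close>. The bound is uniform in \<open>n\<close>.\<close>

lemma mean_close_pairs_le:
  assumes "1 \<le> d"
  shows "mean n (\<lambda>C :: 'a::{finite, field} poly. real (card (close_pairs d C))) \<le> 1 / real d"
proof -
  let ?q = "real CARD('a)"
  let ?\<pi> = "deg_count (prime_polys :: 'a poly set)"
  let ?Y = "{P. P \<in> (prime_polys :: 'a poly set) \<and> degree P \<in> {d<..} \<and> degree P \<le> n}"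
  let ?Z = "\<lambda>P. {Q \<in> (prime_polys :: 'a poly set). degree Q = degree P}"
  let ?X = "SIGMA P:?Y. ?Z P - {P}"
  have finY: "finite ?Y"
    by (rule finite_subset[OF _ finite_polys_degree_le[of n]]) auto
  then have fin: "finite ?X" by auto
  have "mean n (\<lambda>C :: 'a poly. real (card (close_pairs d C)))
      = mean n (\<lambda>C. \<Sum>x\<in>?X. of_bool (fst x * snd x dvd C))"
  proof (rule mean_cong)
    fix C :: "'a poly" assume C: "C \<in> monics n"
    have "P * Q dvd C \<longleftrightarrow> P dvd C \<and> Q dvd C"
      if "P \<in> prime_polys" "Q \<in> prime_polys" "P \<noteq> Q" for P Q
      using prod_primes_dvd_iff[of "{P, Q}" C] that by (auto simp: prime_divisors_def)
    then have "close_pairs d C = ?X \<inter> {x. fst x * snd x dvd C}"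
      using degree_prime_divisor_le[OF C] by (auto simp: close_pairs_def prime_divisors_def)
    then show "real (card (close_pairs d C)) = (\<Sum>x\<in>?X. of_bool (fst x * snd x dvd C))"
      using fin by simp
  qed
  also have "\<dots> \<le> (\<Sum>(P, Q)\<in>?X. 1 / ?q ^ (2 * degree P))"
    unfolding mean_sum
  proof (rule sum_mono)
    fix x assume "x \<in> ?X"
    then have x: "fst x \<in> prime_polys" "snd x \<in> prime_polys" "degree (snd x) = degree (fst x)"
      by auto
    then have "monic_poly (fst x * snd x)" "degree (fst x * snd x) = 2 * degree (fst x)"
      using prime_polysD(1)[OF x(1)] prime_polysD(1)[OF x(2)]
      by (simp_all add: monic_poly_mult_iff degree_mult_monic)
    then show "mean n (\<lambda>C. of_bool (fst x * snd x dvd C))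
        \<le> (case x of (P, Q) \<Rightarrow> 1 / ?q ^ (2 * degree P))"
      by (simp add: mean_of_bool_dvd case_prod_unfold divide_right_mono)
  qed
  also have "\<dots> = (\<Sum>P\<in>?Y. \<Sum>Q\<in>?Z P - {P}. 1 / ?q ^ (2 * degree P))"
    using finY by (subst sum.Sigma) auto
  also have "\<dots> \<le> (\<Sum>P\<in>?Y. real (?\<pi> (degree P)) / ?q ^ (2 * degree P))"
  proof (rule sum_mono)
    fix P
    have "card (?Z P - {P}) \<le> ?\<pi> (degree P)"
      unfolding deg_count_def by (rule card_mono) auto
    then show "(\<Sum>Q\<in>?Z P - {P}. 1 / ?q ^ (2 * degree P)) \<le> real (?\<pi> (degree P)) / ?q ^ (2 * degree P)"
      by (simp add: divide_right_mono)
  qed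
  also have "\<dots> = (\<Sum>m\<in>{d<..} \<inter> {..n}. real (?\<pi> m) * (real (?\<pi> m) / ?q ^ (2 * m)))"
    by (rule sum_by_degree) simp
  also have "\<dots> \<le> (\<Sum>m\<in>{d<..n}. 1 / real m ^ 2)"
  proof -
    have "real (?\<pi> m) * (real (?\<pi> m) / ?q ^ (2 * m)) \<le> 1 / real m ^ 2" if "d < m" for m
    proof -
      have "real (m * ?\<pi> m) \<le> real (CARD('a) ^ m)"
        using prime_count_upper[of m, where 'a = 'a] that by (intro of_nat_mono) simp
      then have "real (?\<pi> m) / ?q ^ m \<le> 1 / real m"
        using that by (simp add: field_simps)
      then have "(real (?\<pi> m) / ?q ^ m) ^ 2 \<le> (1 / real m) ^ 2"
        by (rule power_mono) simp
      then show ?thesis by (simp add: power_divide power2_eq_square power_mult mult_2 power_add)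
    qed
    moreover have "{d<..} \<inter> {..n} = {d<..n}" by auto
    ultimately show ?thesis by (auto intro: sum_mono)
  qed
  also have "\<dots> \<le> 1 / real d" by (rule sum_inverse_squares_le[OF assms])
  finally show ?thesis .
qed

lemma tendsto_mean_rank_count_primes:
  "(\<lambda>n. mean n (\<lambda>C. real (rank_count i (prime_polys :: 'a::{finite, field} poly set) C))) \<longlonglongrightarrow> 1"
proof (rule tendstoI)
  \<comment> \<open>The order of choices matters: the cutoff \<open>?d\<close> is fixed first,
    making the pair term small for every \<open>n\<close>; only then does \<open>n\<close> grow,
    which defeats the constant \<open>?c\<close> depending on \<open>?d\<close>.\<close>
  fix \<epsilon> :: real assume "0 < \<epsilon>"
  then obtain k where k: "1 / real (Suc k) < \<epsilon> / 2"
    using nat_approx_posE[of "\<epsilon> / 2"] by auto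
  let ?d = "Suc k"
  let ?c = "real (card {P \<in> (prime_polys :: 'a poly set). degree P \<le> ?d}) + 1"
  have "(\<lambda>n. ?c * mean n (\<lambda>C :: 'a poly. of_bool (above ?d C < Suc i))) \<longlonglongrightarrow> ?c * 0"
    by (intro tendsto_mult_left tendsto_mean_above_less)
  then have "\<forall>\<^sub>F n in sequentially. ?c * mean n (\<lambda>C :: 'a poly. of_bool (above ?d C < Suc i)) < \<epsilon> / 2"
    by (rule order_tendstoD(2)) (use \<open>0 < \<epsilon>\<close> in simp)
  then show "\<forall>\<^sub>F n in sequentially.
      dist (mean n (\<lambda>C. real (rank_count i (prime_polys :: 'a poly set) C))) 1 < \<epsilon>"
  proof eventually_elim
    case (elim n)
    have "\<bar>mean n (\<lambda>C. real (rank_count i (prime_polys :: 'a poly set) C)) - 1\<bar>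
        = \<bar>mean n (\<lambda>C :: 'a poly. real (rank_count i prime_polys C) - 1)\<bar>"
      by (simp add: mean_diff mean_const)
    also have "\<dots> \<le> mean n (\<lambda>C :: 'a poly. \<bar>real (rank_count i prime_polys C) - 1\<bar>)"
      by (rule abs_mean_le)
    also have "\<dots> \<le> mean n (\<lambda>C :: 'a poly. ?c * of_bool (above ?d C < Suc i) + real (card (close_pairs ?d C)))"
      by (intro mean_mono abs_rank_count_minus_1_le monics_nonzero)
    also have "\<dots> < \<epsilon>"
      unfolding mean_add mean_cmult
      using elim k mean_close_pairs_le[of ?d n, where 'a = 'a] by simp
    finally show ?case by (simp add: dist_real_def)
  qed
qed

section \<open>Passage from all primes to a set with natural density\<close>

text \<open>A Toeplitz summation argument: the mean averages the ratios of the prime counts with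
  nonnegative weights \<open>\<pi>(d) * w n d\<close>. Each weight tends to 0 and their total tends
  to 1 by \<open>tendsto_mean_rank_count_primes\<close>, so the limit \<delta> of the ratios is
  inherited.\<close>

lemma tendsto_mean_rank_count:
  fixes S :: "'a::{finite, field} poly set"
  assumes "S \<subseteq> prime_polys" "has_natural_density S \<delta>"
  shows "(\<lambda>n. mean n (\<lambda>C. real (rank_count i S C))) \<longlonglongrightarrow> \<delta>"
proof -
  let ?\<pi> = "\<lambda>d. real (deg_count (prime_polys :: 'a poly set) d)"
  let ?s = "\<lambda>d. real (deg_count S d)"
  let ?all = "\<lambda>n. mean n (\<lambda>C. real (rank_count i (prime_polys :: 'a poly set) C))"
  let ?S = "\<lambda>n. mean n (\<lambda>C. real (rank_count i S C))"
  define w where "w n d = mean (n - d) (\<lambda>A :: 'a poly. of_bool (above d A = i)) / real CARD('a) ^ d" for n d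
  define \<eta> where "\<eta> d = \<bar>?s d / ?\<pi> d - \<delta>\<bar>" for d
  have w0: "0 \<le> w n d" for n d
    unfolding w_def by (intro divide_nonneg_nonneg mean_nonneg) auto
  have \<eta>0: "0 \<le> \<eta> d" for d by (simp add: \<eta>_def)
  have all: "?all n = (\<Sum>d\<le>n. ?\<pi> d * w n d)" for n
    unfolding w_def by (rule mean_rank_count) simp
  have S: "?S n = (\<Sum>d\<le>n. ?s d * w n d)" for n
    unfolding w_def by (rule mean_rank_count[OF assms(1)])
  have w_lim: "(\<lambda>n. w n d) \<longlonglongrightarrow> 0" for d
  proof -
    \<comment> \<open>Rank exactly \<open>i\<close> is weakened to rank below \<open>Suc i\<close>,
      whose mean is already known to vanish in the limit.\<close>
    let ?h = "\<lambda>n. mean n (\<lambda>A :: 'a poly. of_bool (above d A < Suc i))"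
    have "1 \<le> real CARD('a) ^ d"
      using card_field_ge_2[where 'a = 'a] by (intro one_le_power) simp
    then have shrink: "x / real CARD('a) ^ d \<le> x" if "0 \<le> x" for x
      using that by (simp add: divide_le_eq mult_left_le_one_le mult_le_cancel_left1)
    have le: "mean (n - d) (\<lambda>A :: 'a poly. of_bool (above d A = i)) \<le> ?h (n - d)" for n
      by (rule mean_mono) auto
    have "w n d \<le> ?h (n - d)" for n
      unfolding w_def by (rule order_trans[OF shrink le]) (simp add: mean_nonneg)
    moreover have "(\<lambda>n. ?h (n - d)) \<longlonglongrightarrow> 0"
      by (rule filterlim_compose[OF tendsto_mean_above_less filterlim_minus_const_nat_at_top])
    ultimately show ?thesis
      by (intro tendsto_sandwich[of "\<lambda>_. 0" "\<lambda>n. w n d" _ "\<lambda>n. ?h (n - d)"])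
         (simp_all add: w0)
  qed
  have \<eta>_lim: "\<eta> \<longlonglongrightarrow> 0"
    using assms(2) unfolding has_natural_density_def \<eta>_def
    by (intro tendsto_rabs_zero) (simp add: LIM_zero_iff)
  have s_eq: "\<bar>?s d - \<delta> * ?\<pi> d\<bar> = \<eta> d * ?\<pi> d" for d
  proof (cases "?\<pi> d = 0")
    \<comment> \<open>If no prime has degree \<open>d\<close>, as for \<open>d = 0\<close>, then
      \<open>S\<close> has none either, and both sides vanish whatever the quotient by zero
      contributes to \<open>\<eta> d\<close>.\<close>
    case True
    have "deg_count S d \<le> deg_count (prime_polys :: 'a poly set) d"
      unfolding deg_count_def using assms(1) by (intro card_mono) auto
    then show ?thesis using True by simp
  next
    case False
    then have "?s d - \<delta> * ?\<pi> d = (?s d / ?\<pi> d - \<delta>) * ?\<pi> d" by (simp add: field_simps)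
    then show ?thesis by (simp add: \<eta>_def abs_mult)
  qed
  have "(\<lambda>n. ?S n - \<delta> * ?all n) \<longlonglongrightarrow> 0"
  proof (rule tendstoI)
    fix \<epsilon> :: real assume "0 < \<epsilon>"
    then have "\<forall>\<^sub>F d in sequentially. \<eta> d < \<epsilon> / 4"
      using \<eta>_lim by (intro order_tendstoD(2)) auto
    \<comment> \<open>Degrees from \<open>D\<close> on cost at most \<open>\<epsilon> / 4\<close>
      times a total weight that is eventually below 2; the finitely many smaller degrees have
      weights tending to 0. Each part gets \<open>\<epsilon> / 2\<close>.\<close>
    then obtain D where D: "\<And>d. D \<le> d \<Longrightarrow> \<eta> d < \<epsilon> / 4"
      by (auto simp: eventually_sequentially)
    have "(\<lambda>n. \<Sum>d<D. \<eta> d * ?\<pi> d * w n d) \<longlonglongrightarrow> (\<Sum>d<D. \<eta> d * ?\<pi> d * 0)"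
      by (intro tendsto_sum tendsto_mult_left w_lim)
    then have "\<forall>\<^sub>F n in sequentially. (\<Sum>d<D. \<eta> d * ?\<pi> d * w n d) < \<epsilon> / 2"
      by (rule order_tendstoD(2)) (use \<open>0 < \<epsilon>\<close> in simp)
    moreover have "\<forall>\<^sub>F n in sequentially. ?all n < 2"
      by (rule order_tendstoD(2)[OF tendsto_mean_rank_count_primes]) simp
    ultimately show "\<forall>\<^sub>F n in sequentially. dist (?S n - \<delta> * ?all n) 0 < \<epsilon>"
    proof eventually_elim
      case (elim n)
      have "?S n - \<delta> * ?all n = (\<Sum>d\<le>n. (?s d - \<delta> * ?\<pi> d) * w n d)"
        unfolding S all by (simp add: sum_distrib_left sum_subtractf algebra_simps)
      then have "\<bar>?S n - \<delta> * ?all n\<bar> \<le> (\<Sum>d\<le>n. \<bar>(?s d - \<delta> * ?\<pi> d) * w n d\<bar>)"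
        by (simp add: sum_abs)
      also have "\<dots> = (\<Sum>d\<le>n. \<eta> d * ?\<pi> d * w n d)"
        using w0 by (simp add: abs_mult s_eq)
      also have "\<dots> \<le> (\<Sum>d\<le>n. of_bool (d < D) * (\<eta> d * ?\<pi> d * w n d) + \<epsilon> / 4 * (?\<pi> d * w n d))"
      proof (rule sum_mono)
        fix d
        show "\<eta> d * ?\<pi> d * w n d \<le> of_bool (d < D) * (\<eta> d * ?\<pi> d * w n d) + \<epsilon> / 4 * (?\<pi> d * w n d)"
        proof (cases "d < D")
          case False
          then have "\<eta> d * (?\<pi> d * w n d) \<le> \<epsilon> / 4 * (?\<pi> d * w n d)"
            using D[of d] w0 by (intro mult_right_mono) auto
          then show ?thesis using False by (simp add: mult.assoc)
        qed (use w0 \<open>0 < \<epsilon>\<close> in simp)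
      qed
      also have "\<dots> = (\<Sum>d\<le>n. of_bool (d < D) * (\<eta> d * ?\<pi> d * w n d)) + \<epsilon> / 4 * ?all n"
        unfolding all by (simp only: sum.distrib sum_distrib_left)
      also have "(\<Sum>d\<le>n. of_bool (d < D) * (\<eta> d * ?\<pi> d * w n d)) = (\<Sum>d\<in>{..n} \<inter> {..<D}. \<eta> d * ?\<pi> d * w n d)"
        by (rule sum.mono_neutral_cong_right) auto
      also have "\<dots> \<le> (\<Sum>d<D. \<eta> d * ?\<pi> d * w n d)"
        using w0 \<eta>0 by (intro sum_mono2) auto
      also have "\<epsilon> / 4 * ?all n \<le> \<epsilon> / 4 * 2"
        using elim(2) \<open>0 < \<epsilon>\<close> by (intro mult_left_mono) auto
      finally show ?case using elim(1) by (simp add: dist_real_def)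
    qed
  qed
  moreover have "(\<lambda>n. \<delta> * ?all n) \<longlonglongrightarrow> \<delta> * 1"
    by (intro tendsto_mult_left tendsto_mean_rank_count_primes)
  ultimately have "(\<lambda>n. (?S n - \<delta> * ?all n) + \<delta> * ?all n) \<longlonglongrightarrow> 0 + \<delta> * 1"
    by (rule tendsto_add)
  then show ?thesis by simp
qed

section \<open>Assembly of the duality and the limits\<close>

lemma sum_D_set_eq_mean:
  fixes S :: "'a::{finite, field} poly set"
  shows "(\<Sum>A | monic_poly A \<and> 1 \<le> degree A \<and> degree A \<le> n \<and> A \<in> D_set S.
            real_of_int (moebius_poly A) * real (Omega_deg A) / real CARD('a) ^ degree A)
    = mean n (\<lambda>C. real (rank_count 1 S C)) - mean n (\<lambda>C. real (rank_count 0 S C))"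
proof -
  let ?w = "\<lambda>A. real_of_int (moebius_poly A) * real (Omega_deg A)"
  have "prime_divisors 1 = ({} :: 'a poly set)"
    using prime_divisors_prod[of "{} :: 'a poly set"] by simp
  \<comment> \<open>Since \<open>P_min 1\<close> is empty, degree 0 never occurs in
    \<open>D_set S\<close>, and the sum may be taken over all monic \<open>A\<close> of degree at
    most \<open>n\<close>.\<close>
  then have "(1 :: 'a poly) \<notin> D_set S" by (simp add: D_set_def P_min_def)
  then have pos: "1 \<le> degree A" if "A \<in> D_set S" for A
    using that monic_poly_degree_0[of A] by (cases "degree A = 0") (auto simp: D_set_def)
  have fin: "finite {A :: 'a poly. monic_poly A \<and> degree A \<le> n}"
    by (rule finite_subset[OF _ finite_polys_degree_le[of n]]) auto
  have "(\<Sum>A | monic_poly A \<and> 1 \<le> degree A \<and> degree A \<le> n \<and> A \<in> D_set S. ?w A / real CARD('a) ^ degree A)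
      = (\<Sum>A | monic_poly A \<and> degree A \<le> n. of_bool (A \<in> D_set S) * ?w A / real CARD('a) ^ degree A)"
    by (rule sum.mono_neutral_cong_left[OF fin]) (use pos in auto)
  also have "\<dots> = mean n (\<lambda>C. \<Sum>A | monic_poly A \<and> A dvd C. of_bool (A \<in> D_set S) * ?w A)"
    by (rule sum_over_degree_le_eq_mean)
  also have "\<dots> = mean n (\<lambda>C. real (rank_count 1 S C) - real (rank_count 0 S C))"
  proof (rule mean_cong)
    fix C :: "'a poly" assume "C \<in> monics n"
    then have "C \<noteq> 0" by (rule monics_nonzero)
    have "(\<Sum>P\<in>prime_divisors C \<inter> S. of_bool (above (degree P) C = i)) = real (rank_count i S C)" for i
      using finite_prime_divisors[OF \<open>C \<noteq> 0\<close>] by (simp add: rank_count_def Int_def conj_ac)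
    then show "(\<Sum>A | monic_poly A \<and> A dvd C. of_bool (A \<in> D_set S) * ?w A)
        = real (rank_count 1 S C) - real (rank_count 0 S C)"
      unfolding sum_moebius_Omega_divisors[OF \<open>C \<noteq> 0\<close>] sum_subtractf by simp
  qed
  finally show ?thesis by (simp add: mean_diff)
qed

theorem theorem2p4:
  fixes S :: "'a::{finite, field} poly set"
  assumes "S \<subseteq> prime_polys"
    and "\<exists>\<delta>. has_natural_density S \<delta>"
  shows "((\<lambda>x::real.
            \<Sum>A | monic_poly A \<and> 1 \<le> degree A \<and> real (degree A) \<le> x \<and> A \<in> D_set S.
              real_of_int (moebius_poly A) * real (Omega_deg A) / real CARD('a) ^ degree A)
          \<longlongrightarrow> 0) at_top"
proof -
  let ?M = "\<lambda>i n. mean n (\<lambda>C. real (rank_count i S C))"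
  obtain \<delta> where "has_natural_density S \<delta>" using assms(2) by blast
  then have "(\<lambda>n. ?M 1 n - ?M 0 n) \<longlonglongrightarrow> \<delta> - \<delta>"
    by (intro tendsto_diff tendsto_mean_rank_count[OF assms(1)])
  \<comment> \<open>The sequence limit is composed with the integer part to reach a real
    variable.\<close>
  then have "((\<lambda>x::real. ?M 1 (nat \<lfloor>x\<rfloor>) - ?M 0 (nat \<lfloor>x\<rfloor>)) \<longlongrightarrow> 0) at_top"
    using filterlim_compose[OF _ filterlim_compose[OF filterlim_nat_sequentially filterlim_floor_sequentially]]
    by fastforce
  moreover have "\<forall>\<^sub>F x::real in at_top. ?M 1 (nat \<lfloor>x\<rfloor>) - ?M 0 (nat \<lfloor>x\<rfloor>)
      = (\<Sum>A | monic_poly A \<and> 1 \<le> degree A \<and> real (degree A) \<le> x \<and> A \<in> D_set S.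
          real_of_int (moebius_poly A) * real (Omega_deg A) / real CARD('a) ^ degree A)"
    using eventually_ge_at_top[of 0]
  proof eventually_elim
    case (elim x)
    \<comment> \<open>For negative \<open>x\<close> this would fail at \<open>k = 0\<close>, because
      \<open>nat\<close> truncates to 0; hence the restriction to \<open>x \<ge> 0\<close>.\<close>
    then have "real k \<le> x \<longleftrightarrow> k \<le> nat \<lfloor>x\<rfloor>" for k
      by (simp add: le_nat_floor le_floor_iff nat_le_iff le_nat_iff)
    then show ?case by (simp only: sum_D_set_eq_mean)
  qed
  ultimately show ?thesis by (rule Lim_transform_eventually)
qed

end
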